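(* Let $H$ be a Hilbert space and let $A\subseteq B(H)$ be a subalgebra containing the identity operator $1$ (not necessarily self-adjoint), normed by the operator norm. If there is a diagonal in the Haagerup tensor product $A\otimes_h A$, then $A$ is finite dimensional.
   Context: For $w$ in the algebraic tensor product $A\otimes A$, the Haagerup norm is $\|w\|_h=\inf\{\|\sum_i a_ia_i^*\|^{1/2}\,\|\sum_i b_i^*b_i\|^{1/2}\}$, the infimum over all representations $w=\sum_i a_i\otimes b_i$ as finite sums of elementary tensors; $A\otimes_h A$ denotes the completion of $A\otimes A$ in this norm. The multiplication map $a\otimes b\mapsto ab$ extends to a contractive linear map $m$ from $A\otimes_h A$ into the norm closure of $A$ in $B(H)$, and for each $a\in A$ the maps $b\otimes c\mapsto ab\otimes c$ and $b\otimes c\mapsto b\otimes ca$ extend to bounded maps $u\mapsto a\cdot u$ and $u\mapsto u\cdot a$ on $A\otimes_h A$. A diagonal in $A\otimes_h A$ is an element $u\in A\otimes_h A$ with $m(u)=1$ and $a\cdot u=u\cdot a$ for every $a\in A$ (equivalently, $u=\sum_{i=1}^\infty a_i\otimes b_i$ norm convergent with $\sum_i a_ib_i=1$ and $\sum_i aa_i\otimes b_i=\sum_i a_i\otimes b_ia$ for all $a\in A$). *)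

theory Defs
  imports "HOL-Analysis.Analysis"
begin

class complex_inner = real_normed_vector +
  fixes scaleC :: "complex \<Rightarrow> 'a \<Rightarrow> 'a"
    and cinner :: "'a \<Rightarrow> 'a \<Rightarrow> complex"
  assumes scaleC_add_right: "scaleC c (x + y) = scaleC c x + scaleC c y"
    and scaleC_add_left: "scaleC (c + d) x = scaleC c x + scaleC d x"
    and scaleC_scaleC: "scaleC c (scaleC d x) = scaleC (c * d) x"
    and scaleC_of_real: "scaleC (complex_of_real r) x = scaleR r x"
    and cinner_commute: "cinner x y = cnj (cinner y x)"
    and cinner_add_right: "cinner x (y + z) = cinner x y + cinner x z"
    and cinner_scaleC_right: "cinner x (scaleC c y) = c * cinner x y"
    and cinner_self_norm: "cinner x x = complex_of_real ((norm x)\<^sup>2)"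

class chilbert_space = complex_inner + complete_space

instantiation complex :: chilbert_space
begin
definition scaleC_complex :: "complex \<Rightarrow> complex \<Rightarrow> complex" where
  "scaleC_complex c x = c * x"
definition cinner_complex :: "complex \<Rightarrow> complex \<Rightarrow> complex" where
  "cinner_complex x y = cnj x * y"
instance
proof
  fix x y z c d :: complex and r :: real
  show "scaleC c (x + y) = scaleC c x + scaleC c y"
    by (simp add: scaleC_complex_def algebra_simps)
  show "scaleC (c + d) x = scaleC c x + scaleC d x"
    by (simp add: scaleC_complex_def algebra_simps)
  show "scaleC c (scaleC d x) = scaleC (c * d) x"
    by (simp add: scaleC_complex_def algebra_simps)
  show "scaleC (complex_of_real r) x = scaleR r x"
    by (simp add: scaleC_complex_def scaleR_conv_of_real)
  show "cinner x y = cnj (cinner y x)"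
    by (simp add: cinner_complex_def)
  show "cinner x (y + z) = cinner x y + cinner x z"
    by (simp add: cinner_complex_def algebra_simps)
  show "cinner x (scaleC c y) = c * cinner x y"
    by (simp add: cinner_complex_def scaleC_complex_def algebra_simps)
  show "cinner x x = complex_of_real ((norm x)\<^sup>2)"
    by (metis cinner_complex_def complex_norm_square mult.commute)
qed
end

definition bounded_ops :: "('h::chilbert_space \<Rightarrow> 'h) set" where
  "bounded_ops = {T. bounded_linear T \<and> (\<forall>c x. T (scaleC c x) = scaleC c (T x))}"

definition adj :: "('h::chilbert_space \<Rightarrow> 'h) \<Rightarrow> 'h \<Rightarrow> 'h" where
  "adj T = (\<lambda>y. THE z. \<forall>x. cinner (T x) y = cinner x z)"

definition unital_subalgebra :: "('h::chilbert_space \<Rightarrow> 'h) set \<Rightarrow> bool" where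
  "unital_subalgebra A \<longleftrightarrow> A \<subseteq> bounded_ops \<and> id \<in> A \<and>
     (\<forall>S\<in>A. \<forall>T\<in>A. (\<lambda>x. S x + T x) \<in> A) \<and>
     (\<forall>c. \<forall>T\<in>A. (\<lambda>x. scaleC c (T x)) \<in> A) \<and>
     (\<forall>S\<in>A. \<forall>T\<in>A. S \<circ> T \<in> A)"

definition finite_dim_ops :: "('h::chilbert_space \<Rightarrow> 'h) set \<Rightarrow> bool" where
  "finite_dim_ops A \<longleftrightarrow> (\<exists>F. finite F \<and> F \<subseteq> A \<and>
     (\<forall>T\<in>A. \<exists>c. T = (\<lambda>x. \<Sum>f\<in>F. scaleC (c f) (f x))))"

text \<open>A finite list [(a_1,b_1),...,(a_n,b_n)] represents the algebraic tensor
 sum_i a_i \<otimes> b_i. Two lists represent the same element of B(H) \<otimes> B(H)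
 (hence of A \<otimes> A) iff they induce the same 4-linear form below
 (vector functionals separate the points of B(H)).\<close>
definition tens :: "(('h::chilbert_space \<Rightarrow> 'h) \<times> ('h \<Rightarrow> 'h)) list \<Rightarrow> 'h \<Rightarrow> 'h \<Rightarrow> 'h \<Rightarrow> 'h \<Rightarrow> complex" where
  "tens L = (\<lambda>\<xi> x \<eta> y. \<Sum>(a, b)\<leftarrow>L. cinner \<xi> (a x) * cinner \<eta> (b y))"

definition row_fac :: "(('h::chilbert_space \<Rightarrow> 'h) \<times> ('h \<Rightarrow> 'h)) list \<Rightarrow> real" where
  "row_fac L = sqrt (onorm (\<lambda>x. \<Sum>(a, b)\<leftarrow>L. a (adj a x)))"

definition col_fac :: "(('h::chilbert_space \<Rightarrow> 'h) \<times> ('h \<Rightarrow> 'h)) list \<Rightarrow> real" where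
  "col_fac L = sqrt (onorm (\<lambda>x. \<Sum>(a, b)\<leftarrow>L. adj b (b x)))"

definition haagerup_norm :: "('h::chilbert_space \<Rightarrow> 'h) set \<Rightarrow> (('h \<Rightarrow> 'h) \<times> ('h \<Rightarrow> 'h)) list \<Rightarrow> real" where
  "haagerup_norm A L = Inf {row_fac L' * col_fac L' | L'. set L' \<subseteq> A \<times> A \<and> tens L' = tens L}"

text \<open>Following the equivalent description in the paper: u = sum_i a_i \<otimes> b_i,
 convergent in the Haagerup norm (i.e. partial sums are Cauchy in A \<otimes> A, so
 define an element of the completion), with sum_i a_i b_i = 1 (norm convergent
 in B(H)) and sum_i a a_i \<otimes> b_i = sum_i a_i \<otimes> b_i a in A \<otimes>_h A for all a \<in> A
 (equality of limits in the completion = Haagerup norm of the difference of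
 the partial sums tends to 0).\<close>
definition has_diagonal :: "('h::chilbert_space \<Rightarrow> 'h) set \<Rightarrow> bool" where
  "has_diagonal A \<longleftrightarrow> (\<exists>a b :: nat \<Rightarrow> 'h \<Rightarrow> 'h.
     (\<forall>i. a i \<in> A \<and> b i \<in> A) \<and>
     (\<forall>e>0. \<exists>N. \<forall>m n. N \<le> m \<longrightarrow> m \<le> n \<longrightarrow>
         haagerup_norm A (map (\<lambda>i. (a i, b i)) [m..<n]) < e) \<and>
     (\<lambda>n. onorm (\<lambda>x. (\<Sum>i<n. a i (b i x)) - x)) \<longlonglongrightarrow> 0 \<and>
     (\<forall>c\<in>A. (\<lambda>n. haagerup_norm A
         (map (\<lambda>i. (c \<circ> a i, b i)) [0..<n] @ map (\<lambda>i. (- a i, b i \<circ> c)) [0..<n]))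
       \<longlonglongrightarrow> 0))"

end

theory Submission
  imports Defs "HOL-Library.More_List"
begin

text \<open>Regroup the diagonal into balanced blocks: \<open>u = \<Sum>\<^sub>k a\<^sub>k \<otimes> b\<^sub>k\<close> with \<open>\<Sum> a\<^sub>k a\<^sub>k\<^sup>*\<close> bounded and
  \<open>\<Sum> b\<^sub>k\<^sup>* b\<^sub>k\<close> norm convergent, so that \<open>1 = a b\<close> with a column \<open>b : H \<rightarrow> \<ell>\<^sup>2 \<otimes> H\<close> and a row
  \<open>a : \<ell>\<^sup>2 \<otimes> H \<rightarrow> H\<close>. For a vector functional \<open>g\<close> put \<open>R\<^sub>g = \<Sum>\<^sub>k g(b\<^sub>k) a\<^sub>k\<close>. From \<open>c \<cdot> u = u \<cdot> c\<close> we
  get \<open>c R\<^sub>g = \<Sum>\<^sub>k g(b\<^sub>k c) a\<^sub>k\<close>, and up to a small multiple of \<open>\<parallel>c\<parallel>\<close> this depends only on finitely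
  many of the numbers \<open>g(b\<^sub>k c)\<close>: the map \<open>c \<mapsto> c R\<^sub>g\<close> is compact on \<open>A\<close>. Let \<open>P\<close> be the projection
  of \<open>\<ell>\<^sup>2\<close> onto the closed span of the sequences \<open>(g(b\<^sub>k))\<^sub>k\<close>. Since \<open>(P \<otimes> 1) b = b\<close>, the column \<open>b\<close>
  is a norm limit of finite sums \<open>\<Sum>\<^sub>i P e\<^sub>i \<otimes> b\<^sub>i\<close>, and therefore \<open>1 = a b\<close> is a norm limit of
  finite sums of the compact multipliers \<open>x \<mapsto> a (P e\<^sub>i \<otimes> b\<^sub>i x)\<close>. So the identity map of \<open>A\<close> is
  compact.\<close>

section \<open>Complex Hilbert spaces\<close>

instance chilbert_space \<subseteq> banach ..

lemma scaleC_one [simp]: "scaleC 1 (x::'a::complex_inner) = x"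
  using scaleC_of_real[of 1 x] by simp

lemma cinner_scaleC_left: "cinner (scaleC c x) (z::'a::complex_inner) = cnj c * cinner x z"
  by (metis cinner_scaleC_right cinner_commute complex_cnj_mult)

lemma cinner_add_left: "cinner (x + y) (z::'a::complex_inner) = cinner x z + cinner y z"
  by (metis cinner_add_right cinner_commute complex_cnj_add)

lemma norm_scaleC: "norm (scaleC c (x::'a::complex_inner)) = cmod c * norm x"
proof -
  have "complex_of_real ((norm (scaleC c x))\<^sup>2) = c * cnj c * cinner x x"
    unfolding cinner_self_norm[symmetric] cinner_scaleC_left cinner_scaleC_right by simp
  also have "\<dots> = complex_of_real ((cmod c * norm x)\<^sup>2)"
    unfolding complex_norm_square[symmetric] cinner_self_norm by (simp add: power_mult_distrib)
  finally have "(norm (scaleC c x))\<^sup>2 = (cmod c * norm x)\<^sup>2"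
    using of_real_eq_iff by blast
  then show ?thesis by simp
qed

interpretation scaleC: bounded_bilinear "scaleC :: complex \<Rightarrow> 'a \<Rightarrow> 'a::complex_inner"
proof
  show "\<exists>K. \<forall>c (x::'a). norm (scaleC c x) \<le> norm c * norm x * K"
    by (intro exI[of _ 1]) (simp add: norm_scaleC)
qed (simp_all add: scaleC_add_right scaleC_add_left scaleC_scaleC scaleR_conv_of_real mult.commute
    flip: scaleC_of_real)

lemma norm_add_square:
  "(norm (x + y::'a::complex_inner))\<^sup>2 = (norm x)\<^sup>2 + 2 * Re (cinner x y) + (norm y)\<^sup>2"
proof -
  have "complex_of_real ((norm (x + y))\<^sup>2)
      = of_real ((norm x)\<^sup>2) + (cinner x y + cnj (cinner x y)) + of_real ((norm y)\<^sup>2)"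
    unfolding cinner_self_norm[symmetric] cinner_commute[of y x, symmetric]
    by (simp add: cinner_add_left cinner_add_right)
  then have "complex_of_real ((norm (x + y))\<^sup>2)
      = of_real ((norm x)\<^sup>2 + 2 * Re (cinner x y) + (norm y)\<^sup>2)"
    by (simp add: complex_add_cnj)
  then show ?thesis using of_real_eq_iff by blast
qed

lemma norm_minus_component_square:
  fixes x y :: "'a::complex_inner"
  assumes "y \<noteq> 0"
  shows "(norm (x - scaleC (cinner y x / of_real ((norm y)\<^sup>2)) y))\<^sup>2
    = (norm x)\<^sup>2 - (cmod (cinner y x))\<^sup>2 / (norm y)\<^sup>2"
proof -
  define c where "c = cinner y x / of_real ((norm y)\<^sup>2)"
  have "cinner x (scaleC (- c) y) = - (cinner y x * cnj (cinner y x)) / of_real ((norm y)\<^sup>2)"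
    by (simp add: c_def cinner_scaleC_right cinner_commute[of x y])
  also have "\<dots> = of_real (- (cmod (cinner y x))\<^sup>2 / (norm y)\<^sup>2)"
    using complex_norm_square[of "cinner y x"] by simp
  finally have "Re (cinner x (scaleC (- c) y)) = - (cmod (cinner y x))\<^sup>2 / (norm y)\<^sup>2"
    by simp
  moreover have "(norm (scaleC (- c) y))\<^sup>2 = (cmod (cinner y x))\<^sup>2 / (norm y)\<^sup>2"
    using assms
    by (simp add: norm_scaleC c_def norm_divide norm_mult norm_power power_mult_distrib
        power_divide power2_eq_square)
  ultimately show ?thesis
    using norm_add_square[of x "scaleC (- c) y"] by (simp add: c_def scaleC.minus_left)
qed

lemma norm_cinner_le: "cmod (cinner x y) \<le> norm x * norm (y::'a::complex_inner)"
proof (cases "x = 0")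
  case True
  have "cinner 0 y = 0" using cinner_add_left[of 0 0 y] by simp
  then show ?thesis using True by simp
next
  case False
  have "0 \<le> (norm y)\<^sup>2 - (cmod (cinner x y))\<^sup>2 / (norm x)\<^sup>2"
    unfolding norm_minus_component_square[OF False, symmetric] by simp
  then have "(cmod (cinner x y))\<^sup>2 \<le> (norm x * norm y)\<^sup>2"
    using False by (simp add: field_simps power_mult_distrib)
  then show ?thesis by (rule power2_le_imp_le) simp
qed

interpretation cinner: bounded_bilinear "cinner :: 'a \<Rightarrow> 'a::complex_inner \<Rightarrow> complex"
proof
  show "\<exists>K. \<forall>x y::'a. norm (cinner x y) \<le> norm x * norm y * K"
    by (intro exI[of _ 1]) (simp add: norm_cinner_le)
qed (simp_all add: cinner_add_right cinner_add_left cinner_scaleC_left cinner_scaleC_right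
    scaleR_conv_of_real flip: scaleC_of_real)

lemma cinner_eqI: "(\<And>z. cinner z x = cinner z y) \<Longrightarrow> x = (y::'a::complex_inner)"
proof -
  assume "\<And>z. cinner z x = cinner z y"
  then have "cinner (x - y) (x - y) = 0" by (simp add: cinner.diff_right)
  then show "x = y" by (simp add: cinner_self_norm)
qed

lemma norm_le_if_cinner_le:
  assumes "\<And>z. cmod (cinner z x) \<le> K * norm z" and "0 \<le> K"
  shows "norm (x::'a::complex_inner) \<le> K"
proof (cases "x = 0")
  case False
  have "(norm x)\<^sup>2 \<le> K * norm x"
    using assms(1)[of x] by (simp add: cinner_self_norm norm_power)
  then show ?thesis using False by (simp add: power2_eq_square)
qed (use assms in simp)

lemma parallelogram_law:
  "(norm (x + y))\<^sup>2 + (norm (x - y))\<^sup>2 = 2 * (norm x)\<^sup>2 + 2 * (norm (y::'a::complex_inner))\<^sup>2"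
  using norm_add_square[of x y] norm_add_square[of x "- y"] by (simp add: cinner.minus_right)

locale bounded_clinear = bounded_linear T for T :: "'a::complex_inner \<Rightarrow> 'b::complex_inner" +
  assumes scaleC: "T (scaleC c x) = scaleC c (T x)"

definition csubspace :: "'a::complex_inner set \<Rightarrow> bool" where
  "csubspace S \<longleftrightarrow> subspace S \<and> (\<forall>c. \<forall>x\<in>S. scaleC c x \<in> S)"

lemma csubspace_span:
  assumes "\<And>c x. x \<in> B \<Longrightarrow> scaleC c x \<in> B"
  shows "csubspace (span B)"
proof -
  have "scaleC c x \<in> span B" if "x \<in> span B" for c x
    using that
  proof (induction rule: span_induct)
    case base
    show ?case
      by (auto simp: subspace_def scaleC_add_right scaleC.zero_right span_zero span_add span_scale
          scaleC.scaleR_right)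
  qed (use assms in \<open>auto intro: span_base\<close>)
  then show ?thesis by (simp add: csubspace_def)
qed

lemma subspace_closure:
  fixes S :: "'a::real_normed_vector set"
  assumes "subspace S"
  shows "subspace (closure S)"
  unfolding subspace_def
proof (intro conjI ballI allI)
  show "0 \<in> closure S"
    using subspace_0[OF assms] closure_subset by blast
  show "x + y \<in> closure S" if xy: "x \<in> closure S" "y \<in> closure S" for x y
  proof -
    obtain X Y where "\<forall>n. X n \<in> S" "X \<longlonglongrightarrow> x" "\<forall>n. Y n \<in> S" "Y \<longlonglongrightarrow> y"
      using xy unfolding closure_sequential by blast
    then show ?thesis
      unfolding closure_sequential
      by (intro exI[of _ "\<lambda>n. X n + Y n"]) (auto intro: tendsto_add subspace_add[OF assms])
  qed
  show "c *\<^sub>R x \<in> closure S" if x: "x \<in> closure S" for c x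
  proof -
    obtain X where "\<forall>n. X n \<in> S" "X \<longlonglongrightarrow> x"
      using x unfolding closure_sequential by blast
    then show ?thesis
      unfolding closure_sequential
      by (intro exI[of _ "\<lambda>n. c *\<^sub>R X n"]) (auto intro: tendsto_scaleR subspace_scale[OF assms])
  qed
qed

lemma csubspace_closure:
  assumes "csubspace S"
  shows "csubspace (closure S)"
proof -
  have "scaleC c x \<in> closure S" if x: "x \<in> closure S" for c x
  proof -
    obtain X where "\<forall>n. X n \<in> S" "X \<longlonglongrightarrow> x"
      using x unfolding closure_sequential by blast
    then show ?thesis
      using assms unfolding closure_sequential csubspace_def
      by (intro exI[of _ "\<lambda>n. scaleC c (X n)"]) (auto intro: scaleC.tendsto)
  qed
  then show ?thesis using assms subspace_closure by (auto simp: csubspace_def)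
qed

lemma minimizing_sequence_Cauchy:
  fixes S :: "'a::complex_inner set"
  assumes "convex S" and XS: "\<And>n. X n \<in> S"
    and lim: "(\<lambda>n. norm (x - X n)) \<longlonglongrightarrow> infdist x S"
  shows "Cauchy X"
proof (rule metric_CauchyI)
  fix e :: real assume e: "e > 0"
  define m where "m = infdist x S"
  define d where "d n = (norm (x - X n))\<^sup>2 - m\<^sup>2" for n
  have dist_le: "(norm (X n - X k))\<^sup>2 \<le> 2 * d n + 2 * d k" for n k
  proof -
    let ?mid = "(1/2) *\<^sub>R (X n + X k)"
    have "?mid \<in> S"
      using convexD_alt[OF assms(1) XS XS, of "1/2" n k] by (simp add: algebra_simps)
    then have "m\<^sup>2 \<le> (norm (x - ?mid))\<^sup>2"
      using infdist_le[of ?mid S x]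
      by (intro power_mono) (auto simp: m_def infdist_nonneg dist_norm)
    moreover have "(x - X n) + (x - X k) = 2 *\<^sub>R (x - ?mid)"
      by (simp add: algebra_simps scaleR_2)
    ultimately have "4 * m\<^sup>2 \<le> (norm ((x - X n) + (x - X k)))\<^sup>2"
      by (simp add: power_mult_distrib)
    moreover have "norm ((x - X n) - (x - X k)) = norm (X n - X k)"
      by (simp add: norm_minus_commute)
    ultimately show ?thesis
      using parallelogram_law[of "x - X n" "x - X k"] by (simp add: d_def)
  qed
  have "d \<longlonglongrightarrow> 0"
    using tendsto_diff[OF tendsto_power[OF lim, of 2] tendsto_const[of "m\<^sup>2"]]
    by (simp add: d_def[abs_def] m_def)
  then obtain N where N: "\<And>n. n \<ge> N \<Longrightarrow> \<bar>d n\<bar> < e\<^sup>2 / 4"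
    using LIMSEQ_D[of d 0 "e\<^sup>2 / 4"] e by auto
  have "dist (X n) (X k) < e" if "n \<ge> N" "k \<ge> N" for n k
  proof -
    have "(norm (X n - X k))\<^sup>2 < e\<^sup>2" using dist_le[of n k] N[OF that(1)] N[OF that(2)] by linarith
    then show ?thesis using e by (simp add: dist_norm power2_less_imp_less)
  qed
  then show "\<exists>N. \<forall>n\<ge>N. \<forall>k\<ge>N. dist (X n) (X k) < e" by blast
qed

lemma closest_point_in_complete_convex:
  fixes S :: "'a::complex_inner set"
  assumes "complete S" "convex S" "S \<noteq> {}"
  obtains p where "p \<in> S" and "\<And>s. s \<in> S \<Longrightarrow> norm (x - p) \<le> norm (x - s)"
proof -
  define m where "m = infdist x S"
  have m_le: "m \<le> norm (x - s)" if "s \<in> S" for s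
    using infdist_le[OF that, of x] by (simp add: m_def dist_norm)
  have "\<exists>s\<in>S. norm (x - s) < m + 1 / real (Suc n)" for n
  proof (rule ccontr)
    assume "\<not> ?thesis"
    then have "m + 1 / real (Suc n) \<le> m"
      unfolding m_def infdist_notempty[OF assms(3)]
      using assms(3) by (intro cINF_greatest) (force simp: dist_norm)+
    then show False by (simp add: field_simps)
  qed
  then obtain X where XS: "\<And>n. X n \<in> S" and X: "\<And>n. norm (x - X n) < m + 1 / real (Suc n)"
    by metis
  have lim: "(\<lambda>n. norm (x - X n)) \<longlonglongrightarrow> m"
  proof (rule tendsto_sandwich[OF _ _ tendsto_const])
    show "(\<lambda>n. m + 1 / real (Suc n)) \<longlonglongrightarrow> m"
      using tendsto_add[OF tendsto_const LIMSEQ_Suc[OF lim_1_over_n]] by simp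
  qed (use m_le XS X in \<open>auto intro!: always_eventually less_imp_le[of "norm _"]\<close>)
  then have "Cauchy X"
    using minimizing_sequence_Cauchy[of S X x] assms(2) XS by (simp add: m_def)
  then obtain p where p: "p \<in> S" "X \<longlonglongrightarrow> p"
    using assms(1) XS unfolding complete_def by blast
  have "norm (x - p) = m"
    using LIMSEQ_unique[OF tendsto_norm[OF tendsto_diff[OF tendsto_const p(2)]] lim] .
  then show ?thesis using that p(1) m_le by simp
qed

theorem orthogonal_projection_exists:
  fixes S :: "'a::chilbert_space set"
  assumes "closed S" "csubspace S"
  obtains p where "p \<in> S" and "\<And>s. s \<in> S \<Longrightarrow> cinner s (x - p) = 0"
proof -
  have S: "subspace S" and scaleC_mem: "\<And>c s. s \<in> S \<Longrightarrow> scaleC c s \<in> S"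
    using assms(2) by (auto simp: csubspace_def)
  obtain p where p: "p \<in> S" and closest: "\<And>s. s \<in> S \<Longrightarrow> norm (x - p) \<le> norm (x - s)"
    using closest_point_in_complete_convex[of S x] assms(1)
      subspace_imp_convex[OF S] subspace_0[OF S]
    by (auto simp: complete_eq_closed)
  have "cinner s (x - p) = 0" if s: "s \<in> S" for s
  proof (cases "s = 0")
    case False
    define c where "c = cinner s (x - p) / of_real ((norm s)\<^sup>2)"
    have "(norm (x - p))\<^sup>2 \<le> (norm ((x - p) - scaleC c s))\<^sup>2"
      using closest[OF subspace_add[OF S p scaleC_mem[OF s, of c]]]
      by (intro power_mono) (simp_all add: diff_diff_eq)
    then have "(cmod (cinner s (x - p)))\<^sup>2 / (norm s)\<^sup>2 \<le> 0"
      unfolding c_def norm_minus_component_square[OF False] by simp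
    then show ?thesis using False by (simp add: divide_le_0_iff)
  qed (simp add: cinner.zero_left)
  then show ?thesis using that p by blast
qed

theorem riesz_representation:
  fixes f :: "'a::chilbert_space \<Rightarrow> complex"
  assumes "bounded_clinear f"
  obtains z where "\<And>x. f x = cinner z x"
proof (cases "\<forall>x. f x = 0")
  case True
  then show ?thesis using that[of 0] by (simp add: cinner.zero_left)
next
  case False
  then obtain x0 where x0: "f x0 \<noteq> 0" by blast
  interpret f: bounded_clinear f by fact
  define K where "K = {x. f x = 0}"
  have "closed K"
    unfolding K_def
    by (intro closed_Collect_eq continuous_on_const linear_continuous_on f.bounded_linear_axioms)
  moreover have "csubspace K"
    by (auto simp: csubspace_def subspace_def K_def f.zero f.add f.scaleR f.scaleC
        scaleC_complex_def)
  ultimately obtain p where p: "p \<in> K" "\<And>s. s \<in> K \<Longrightarrow> cinner s (x0 - p) = 0"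
    using orthogonal_projection_exists[of K x0] by blast
  define e where "e = x0 - p"
  have fe: "f e \<noteq> 0" using x0 p(1) by (simp add: e_def f.diff K_def)
  then have ee: "cinner e e \<noteq> 0" using f.zero by (auto simp: cinner_self_norm)
  have "f x = cinner (scaleC (cnj (f e / cinner e e)) e) x" for x
  proof -
    have "scaleC (f e) x - scaleC (f x) e \<in> K"
      by (simp add: K_def f.diff f.scaleC scaleC_complex_def)
    from p(2)[OF this, folded e_def] have "cinner e (scaleC (f e) x - scaleC (f x) e) = 0"
      by (metis cinner_commute complex_cnj_zero)
    then have "f e * cinner e x = f x * cinner e e"
      by (simp add: cinner.diff_right cinner_scaleC_right)
    then show ?thesis using ee by (simp add: cinner_scaleC_left field_simps)
  qed
  then show ?thesis using that by blast
qed

definition cadjoint :: "('a::complex_inner \<Rightarrow> 'b::complex_inner) \<Rightarrow> 'b \<Rightarrow> 'a" where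
  "cadjoint T = (\<lambda>y. THE z. \<forall>x. cinner (T x) y = cinner x z)"

lemma adj_eq_cadjoint: "adj = cadjoint"
  by (simp add: adj_def cadjoint_def fun_eq_iff)

lemma cinner_cadjoint:
  fixes T :: "'a::chilbert_space \<Rightarrow> 'b::complex_inner"
  assumes "bounded_clinear T"
  shows "cinner x (cadjoint T y) = cinner (T x) y"
proof -
  interpret T: bounded_clinear T by fact
  have "bounded_clinear (\<lambda>x. cinner y (T x))"
    by (intro bounded_clinear.intro bounded_clinear_axioms.intro
        bounded_linear_compose[OF cinner.bounded_linear_right T.bounded_linear_axioms])
      (simp add: T.scaleC cinner_scaleC_right scaleC_complex_def)
  then obtain z where "\<And>x. cinner y (T x) = cinner z x"
    using riesz_representation by blast
  then have z: "\<forall>x. cinner (T x) y = cinner x z" by (metis cinner_commute)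
  have "\<forall>x. cinner (T x) y = cinner x (cadjoint T y)"
    unfolding cadjoint_def
  proof (rule theI[of "\<lambda>z. \<forall>x. cinner (T x) y = cinner x z", OF z])
    show "w = z" if "\<forall>x. cinner (T x) y = cinner x w" for w
      by (rule cinner_eqI) (use that z in simp)
  qed
  then show ?thesis by simp
qed

lemma cinner_cadjoint_left:
  fixes T :: "'a::chilbert_space \<Rightarrow> 'b::complex_inner"
  assumes "bounded_clinear T"
  shows "cinner (cadjoint T y) x = cinner y (T x)"
  by (metis assms cinner_cadjoint cinner_commute)

lemma norm_cadjoint_le:
  fixes T :: "'a::chilbert_space \<Rightarrow> 'b::complex_inner"
  assumes T: "bounded_clinear T" and "0 \<le> K" and bound: "\<And>x. norm (T x) \<le> K * norm x"
  shows "norm (cadjoint T y) \<le> K * norm y"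
proof (rule norm_le_if_cinner_le)
  fix z
  have "cmod (cinner z (cadjoint T y)) \<le> norm (T z) * norm y"
    unfolding cinner_cadjoint[OF T] by (rule norm_cinner_le)
  also have "\<dots> \<le> K * norm z * norm y" by (intro mult_right_mono bound) simp
  finally show "cmod (cinner z (cadjoint T y)) \<le> K * norm y * norm z" by (simp add: mult_ac)
qed (use assms(2) in simp)

lemma bounded_clinear_cadjoint:
  fixes T :: "'a::chilbert_space \<Rightarrow> 'b::complex_inner"
  assumes T: "bounded_clinear T"
  shows "bounded_clinear (cadjoint T)"
proof -
  interpret T: bounded_clinear T by fact
  obtain K where K: "K > 0" "\<And>x. norm (T x) \<le> norm x * K" using T.pos_bounded by blast
  show ?thesis
  proof
    show "cadjoint T (x + y) = cadjoint T x + cadjoint T y" for x y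
      by (rule cinner_eqI) (simp add: cinner_add_right cinner_cadjoint[OF T])
    show "cadjoint T (r *\<^sub>R x) = r *\<^sub>R cadjoint T x" for r x
      by (rule cinner_eqI) (simp add: cinner.scaleR_right cinner_cadjoint[OF T])
    show "cadjoint T (scaleC c x) = scaleC c (cadjoint T x)" for c x
      by (rule cinner_eqI) (simp add: cinner_scaleC_right cinner_cadjoint[OF T])
    show "\<exists>K. \<forall>x. norm (cadjoint T x) \<le> norm x * K"
      using norm_cadjoint_le[OF T, of K] K by (intro exI[of _ K]) (simp add: mult.commute)
  qed
qed

lemma bounded_clinear_0: "bounded_clinear (\<lambda>x. 0)"
  by (simp add: bounded_clinear_def bounded_clinear_axioms_def scaleC.zero_right)

lemma bounded_clinear_scaleR:
  assumes "bounded_clinear T"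
  shows "bounded_clinear (\<lambda>x. r *\<^sub>R T x)"
proof -
  interpret T: bounded_clinear T by fact
  show ?thesis
    by (intro bounded_clinear.intro bounded_clinear_axioms.intro bounded_linear_scaleR_right
        bounded_linear_compose[OF bounded_linear_scaleR_right T.bounded_linear_axioms])
      (simp add: T.scaleC scaleC.scaleR_right)
qed

lemma cadjoint_cadjoint:
  fixes T :: "'a::chilbert_space \<Rightarrow> 'b::chilbert_space"
  assumes "bounded_clinear T"
  shows "cadjoint (cadjoint T) = T"
  by (rule ext, rule cinner_eqI)
    (simp add: cinner_cadjoint cinner_cadjoint_left bounded_clinear_cadjoint assms)

lemma cadjoint_scaleR:
  fixes T :: "'a::chilbert_space \<Rightarrow> 'b::complex_inner"
  assumes "bounded_clinear T"
  shows "cadjoint (\<lambda>x. r *\<^sub>R T x) y = r *\<^sub>R cadjoint T y"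
  by (rule cinner_eqI)
    (simp add: cinner_cadjoint bounded_clinear_scaleR assms cinner.scaleR_left cinner.scaleR_right)

lemma cadjoint_0: "cadjoint (\<lambda>x::'a::chilbert_space. 0::'b::complex_inner) = (\<lambda>y. 0)"
  by (rule ext, rule cinner_eqI)
    (simp add: cinner_cadjoint[OF bounded_clinear_0] cinner.zero_left cinner.zero_right)

section \<open>Square-summable families\<close>

definition square_summable :: "('i \<Rightarrow> 'a::real_normed_vector) \<Rightarrow> bool" where
  "square_summable z \<longleftrightarrow> (\<lambda>k. (norm (z k))\<^sup>2) summable_on UNIV"

definition l2_norm :: "('i \<Rightarrow> 'a::real_normed_vector) \<Rightarrow> real" where
  "l2_norm z = sqrt (\<Sum>\<^sub>\<infinity>k. (norm (z k))\<^sup>2)"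

lemma l2_norm_bound:
  assumes "\<And>F. finite F \<Longrightarrow> L2_set (\<lambda>k. norm (z k)) F \<le> C"
  shows "square_summable z" and "l2_norm z \<le> C"
proof -
  have C: "0 \<le> C" using assms[of "{}"] by simp
  have sum_le: "(\<Sum>k\<in>F. (norm (z k))\<^sup>2) \<le> C\<^sup>2" if "finite F" for F
    using assms[OF that] by (simp add: L2_set_def sqrt_le_D)
  then show z: "square_summable z"
    unfolding square_summable_def
    by (intro nonneg_bdd_above_summable_on) (auto intro!: bdd_aboveI2)
  then show "l2_norm z \<le> C"
    using C unfolding l2_norm_def square_summable_def
    by (intro real_le_lsqrt infsum_le_finite_sums infsum_nonneg) (auto intro: sum_le)
qed

lemma L2_set_le_l2_norm:
  assumes "square_summable z" "finite F"
  shows "L2_set (\<lambda>k. norm (z k)) F \<le> l2_norm z"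
  unfolding L2_set_def l2_norm_def
  by (intro real_sqrt_le_mono finite_sum_le_infsum)
    (use assms in \<open>auto simp: square_summable_def\<close>)

lemma l2_norm_nonneg: "0 \<le> l2_norm z"
  by (simp add: l2_norm_def infsum_nonneg)

lemma norm_le_l2_norm: "square_summable z \<Longrightarrow> norm (z k) \<le> l2_norm z"
  using L2_set_le_l2_norm[of z "{k}"] by simp

lemma
  assumes "square_summable y" "square_summable z"
  shows square_summable_add: "square_summable (\<lambda>k. y k + z k)"
    and l2_norm_triangle_ineq: "l2_norm (\<lambda>k. y k + z k) \<le> l2_norm y + l2_norm z"
proof -
  have L2_le: "L2_set (\<lambda>k. norm (y k + z k)) F \<le> l2_norm y + l2_norm z" if F: "finite F" for F
  proof -
    have "L2_set (\<lambda>k. norm (y k + z k)) F \<le> L2_set (\<lambda>k. norm (y k) + norm (z k)) F"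
      by (intro L2_set_mono norm_triangle_ineq) simp
    also have "\<dots> \<le> L2_set (\<lambda>k. norm (y k)) F + L2_set (\<lambda>k. norm (z k)) F"
      by (rule L2_set_triangle_ineq)
    also have "\<dots> \<le> l2_norm y + l2_norm z"
      by (intro add_mono L2_set_le_l2_norm assms F)
    finally show ?thesis .
  qed
  show "square_summable (\<lambda>k. y k + z k)" "l2_norm (\<lambda>k. y k + z k) \<le> l2_norm y + l2_norm z"
    using l2_norm_bound[OF L2_le] by auto
qed

lemma
  assumes "\<And>k. norm (y k) = c * norm (z k)" "0 \<le> c"
  shows square_summable_rescale: "square_summable z \<Longrightarrow> square_summable y"
    and l2_norm_rescale: "l2_norm y = c * l2_norm z"
  using assms unfolding square_summable_def l2_norm_def
  by (simp_all add: power_mult_distrib summable_on_cmult_right infsum_cmult_right' real_sqrt_mult)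

lemma square_summable_scaleR: "square_summable z \<Longrightarrow> square_summable (\<lambda>k. r *\<^sub>R z k)"
  by (rule square_summable_rescale[of _ "\<bar>r\<bar>"]) auto

lemma square_summable_uminus: "square_summable z \<Longrightarrow> square_summable (\<lambda>k. - z k)"
  by (rule square_summable_rescale[of _ 1]) auto

lemma square_summable_diff:
  "square_summable y \<Longrightarrow> square_summable z \<Longrightarrow> square_summable (\<lambda>k. y k - z k)"
  using square_summable_add[OF _ square_summable_uminus] by fastforce

typedef (overloaded) ('i, 'a::real_normed_vector) ell2 = "{z :: 'i \<Rightarrow> 'a. square_summable z}"
  morphisms ell2_nth ell2_of
  by (rule exI[of _ "\<lambda>_. 0"]) (simp add: square_summable_def)

setup_lifting type_definition_ell2

lemma ell2_eqI: "(\<And>k. ell2_nth y k = ell2_nth z k) \<Longrightarrow> y = z"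
  by transfer auto

lemma square_summable_ell2_nth: "square_summable (ell2_nth z)"
  using ell2_nth by blast

lemma ell2_nth_of: "square_summable z \<Longrightarrow> ell2_nth (ell2_of z) = z"
  by (simp add: ell2_of_inverse)

instantiation ell2 :: (type, real_normed_vector) real_vector
begin

lift_definition zero_ell2 :: "('a, 'b) ell2" is "\<lambda>_. 0"
  by (simp add: square_summable_def)

lift_definition plus_ell2 :: "('a, 'b) ell2 \<Rightarrow> ('a, 'b) ell2 \<Rightarrow> ('a, 'b) ell2"
  is "\<lambda>y z k. y k + z k"
  by (rule square_summable_add)

lift_definition uminus_ell2 :: "('a, 'b) ell2 \<Rightarrow> ('a, 'b) ell2" is "\<lambda>z k. - z k"
  by (rule square_summable_uminus)

lift_definition minus_ell2 :: "('a, 'b) ell2 \<Rightarrow> ('a, 'b) ell2 \<Rightarrow> ('a, 'b) ell2"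
  is "\<lambda>y z k. y k - z k"
  by (rule square_summable_diff)

lift_definition scaleR_ell2 :: "real \<Rightarrow> ('a, 'b) ell2 \<Rightarrow> ('a, 'b) ell2"
  is "\<lambda>r z k. r *\<^sub>R z k"
  by (rule square_summable_scaleR)

instance
proof
  fix x y z :: "('a, 'b) ell2" and r s :: real
  show "x + y + z = x + (y + z)" "x + y = y + x" "0 + x = x" "- x + x = 0" "x - y = x + - y"
    by (transfer; simp add: add_ac)+
  show "r *\<^sub>R (x + y) = r *\<^sub>R x + r *\<^sub>R y" "(r + s) *\<^sub>R x = r *\<^sub>R x + s *\<^sub>R x"
    "r *\<^sub>R s *\<^sub>R x = (r * s) *\<^sub>R x" "1 *\<^sub>R x = x"
    by (transfer; simp add: algebra_simps)+
qed

end

instantiation ell2 :: (type, real_normed_vector) real_normed_vector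
begin

lift_definition norm_ell2 :: "('a, 'b) ell2 \<Rightarrow> real" is l2_norm .

definition dist_ell2 :: "('a, 'b) ell2 \<Rightarrow> ('a, 'b) ell2 \<Rightarrow> real" where
  "dist_ell2 y z = norm (y - z)"

definition sgn_ell2 :: "('a, 'b) ell2 \<Rightarrow> ('a, 'b) ell2" where
  "sgn_ell2 z = z /\<^sub>R norm z"

definition uniformity_ell2 :: "(('a, 'b) ell2 \<times> ('a, 'b) ell2) filter" where
  "uniformity_ell2 = (INF e\<in>{0 <..}. principal {(x, y). dist x y < e})"

definition open_ell2 :: "('a, 'b) ell2 set \<Rightarrow> bool" where
  "open_ell2 S = (\<forall>x\<in>S. \<forall>\<^sub>F (x', y) in uniformity. x' = x \<longrightarrow> y \<in> S)"

instance
proof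
  fix x y :: "('a, 'b) ell2" and r :: real
  show "norm x = 0 \<longleftrightarrow> x = 0"
  proof transfer
    fix z :: "'a \<Rightarrow> 'b" assume "square_summable z"
    from norm_le_l2_norm[OF this] show "l2_norm z = 0 \<longleftrightarrow> z = (\<lambda>_. 0)"
      by (auto simp: fun_eq_iff l2_norm_def)
  qed
  show "norm (x + y) \<le> norm x + norm y"
    by transfer (rule l2_norm_triangle_ineq)
  show "norm (r *\<^sub>R x) = \<bar>r\<bar> * norm x"
    by transfer (auto intro: l2_norm_rescale)
qed (simp_all add: dist_ell2_def sgn_ell2_def uniformity_ell2_def open_ell2_def)

end

lemma ell2_nth_simps [simp]:
  "ell2_nth 0 k = 0" "ell2_nth (y + z) k = ell2_nth y k + ell2_nth z k"
  "ell2_nth (- z) k = - ell2_nth z k" "ell2_nth (y - z) k = ell2_nth y k - ell2_nth z k"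
  "ell2_nth (r *\<^sub>R z) k = r *\<^sub>R ell2_nth z k"
  by (simp_all add: zero_ell2.rep_eq plus_ell2.rep_eq uminus_ell2.rep_eq minus_ell2.rep_eq
      scaleR_ell2.rep_eq)

lemma norm_ell2_nth_le: "norm (ell2_nth z k) \<le> norm z"
  by transfer (rule norm_le_l2_norm)

lemma L2_set_ell2_nth_le: "finite F \<Longrightarrow> L2_set (\<lambda>k. norm (ell2_nth z k)) F \<le> norm z"
  by transfer (rule L2_set_le_l2_norm)

lemma norm_ell2_le:
  "(\<And>F. finite F \<Longrightarrow> L2_set (\<lambda>k. norm (ell2_nth z k)) F \<le> C) \<Longrightarrow> norm z \<le> C"
  by transfer (rule l2_norm_bound)

lemma bounded_linear_ell2_nth: "bounded_linear (\<lambda>z. ell2_nth z k)"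
  by (rule bounded_linear_intro[where K = 1]) (simp_all add: norm_ell2_nth_le)

lemma ell2_nth_sum: "ell2_nth (\<Sum>i\<in>M. z i) k = (\<Sum>i\<in>M. ell2_nth (z i) k)"
  by (rule linear_sum[OF bounded_linear.linear[OF bounded_linear_ell2_nth]])

lemma norm_diff_coordinatewise_limit_le:
  fixes X :: "nat \<Rightarrow> ('i, 'a::real_normed_vector) ell2"
  assumes "\<And>m. N \<le> m \<Longrightarrow> norm (X n - X m) \<le> e" and lim: "\<And>k. (\<lambda>m. ell2_nth (X m) k) \<longlonglongrightarrow> z k"
  shows "norm (X n - ell2_of z) \<le> e"
proof -
  have L2_le: "L2_set (\<lambda>k. norm (ell2_nth (X n) k - z k)) F \<le> e" if F: "finite F" for F
  proof (rule LIMSEQ_le_const2)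
    show "(\<lambda>m. L2_set (\<lambda>k. norm (ell2_nth (X n) k - ell2_nth (X m) k)) F)
        \<longlonglongrightarrow> L2_set (\<lambda>k. norm (ell2_nth (X n) k - z k)) F"
      unfolding L2_set_def by (intro tendsto_intros lim)
    show "\<exists>N. \<forall>m\<ge>N. L2_set (\<lambda>k. norm (ell2_nth (X n) k - ell2_nth (X m) k)) F \<le> e"
      using L2_set_ell2_nth_le[OF F, of "X n - X m" for m] assms(1) by (auto intro: order_trans)
  qed
  then have "square_summable (\<lambda>k. ell2_nth (X n) k - z k)" by (rule l2_norm_bound)
  from square_summable_diff[OF square_summable_ell2_nth[of "X n"] this]
  have "square_summable z" by simp
  then show ?thesis
    using L2_le by (intro norm_ell2_le) (simp add: ell2_nth_of)
qed

instance ell2 :: (type, banach) banach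
proof
  fix X :: "nat \<Rightarrow> ('a, 'b) ell2"
  assume X: "Cauchy X"
  have "convergent (\<lambda>n. ell2_nth (X n) k)" for k
    using bounded_linear.Cauchy[OF bounded_linear_ell2_nth X] by (rule Cauchy_convergent)
  then obtain z where z: "\<And>k. (\<lambda>n. ell2_nth (X n) k) \<longlonglongrightarrow> z k"
    unfolding convergent_def by metis
  have "X \<longlonglongrightarrow> ell2_of z"
  proof (rule LIMSEQ_I)
    fix e :: real assume "e > 0"
    then obtain N where N: "\<And>n m. N \<le> n \<Longrightarrow> N \<le> m \<Longrightarrow> norm (X n - X m) < e / 2"
      using CauchyD[OF X, of "e / 2"] by auto
    have "norm (X n - ell2_of z) \<le> e / 2" if "N \<le> n" for n
      using norm_diff_coordinatewise_limit_le[OF _ z] N[OF that] by (meson less_imp_le)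
    then show "\<exists>N. \<forall>n\<ge>N. norm (X n - ell2_of z) < e"
      using \<open>e > 0\<close> by fastforce
  qed
  then show "convergent X" by (rule convergentI)
qed

lemma summable_on_cinner:
  fixes y z :: "'i \<Rightarrow> 'a::complex_inner"
  assumes "square_summable y" "square_summable z"
  shows "(\<lambda>k. cinner (y k) (z k)) summable_on UNIV"
proof -
  have "(\<Sum>k\<in>F. cmod (cinner (y k) (z k))) \<le> l2_norm y * l2_norm z" if "finite F" for F
  proof -
    have "(\<Sum>k\<in>F. cmod (cinner (y k) (z k))) \<le> (\<Sum>k\<in>F. \<bar>norm (y k)\<bar> * \<bar>norm (z k)\<bar>)"
      by (intro sum_mono) (simp add: norm_cinner_le)
    also have "\<dots> \<le> L2_set (\<lambda>k. norm (y k)) F * L2_set (\<lambda>k. norm (z k)) F"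
      by (rule L2_set_mult_ineq)
    also have "\<dots> \<le> l2_norm y * l2_norm z"
      by (intro mult_mono L2_set_le_l2_norm assms that L2_set_nonneg l2_norm_nonneg)
    finally show ?thesis .
  qed
  then have "(\<lambda>k. cmod (cinner (y k) (z k))) summable_on UNIV"
    by (intro nonneg_bdd_above_summable_on) (auto intro!: bdd_aboveI2)
  then show ?thesis by (rule abs_summable_summable)
qed

instantiation ell2 :: (type, complex_inner) complex_inner
begin

lift_definition scaleC_ell2 :: "complex \<Rightarrow> ('a, 'b) ell2 \<Rightarrow> ('a, 'b) ell2"
  is "\<lambda>c z k. scaleC c (z k)"
  by (rule square_summable_rescale[of _ "cmod _"]) (auto simp: norm_scaleC)

lift_definition cinner_ell2 :: "('a, 'b) ell2 \<Rightarrow> ('a, 'b) ell2 \<Rightarrow> complex"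
  is "\<lambda>y z. \<Sum>\<^sub>\<infinity>k. cinner (y k) (z k)" .

instance
proof
  fix x y z :: "('a, 'b) ell2" and c d :: complex and r :: real
  show "scaleC c (x + y) = scaleC c x + scaleC c y" "scaleC (c + d) x = scaleC c x + scaleC d x"
    "scaleC c (scaleC d x) = scaleC (c * d) x" "scaleC (complex_of_real r) x = r *\<^sub>R x"
    by (transfer; simp add: scaleC_add_right scaleC_add_left scaleC_scaleC scaleC_of_real)+
  show "cinner x y = cnj (cinner y x)"
    unfolding cinner_ell2.rep_eq infsum_cnj[symmetric] by (intro infsum_cong cinner_commute)
  show "cinner x (y + z) = cinner x y + cinner x z"
    by transfer (simp add: cinner_add_right infsum_add summable_on_cinner)
  show "cinner x (scaleC c y) = c * cinner x y"
    by transfer (simp add: cinner_scaleC_right infsum_cmult_right')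
  show "cinner x x = complex_of_real ((norm x)\<^sup>2)"
  proof transfer
    fix z :: "'a \<Rightarrow> 'b" assume "square_summable z"
    then have "((\<lambda>k. cinner (z k) (z k)) has_sum complex_of_real (\<Sum>\<^sub>\<infinity>k. (norm (z k))\<^sup>2)) UNIV"
      unfolding cinner_self_norm square_summable_def by (intro has_sum_of_real has_sum_infsum)
    then show "(\<Sum>\<^sub>\<infinity>k. cinner (z k) (z k)) = complex_of_real ((l2_norm z)\<^sup>2)"
      by (simp add: infsumI l2_norm_def infsum_nonneg)
  qed
qed

end

instance ell2 :: (type, chilbert_space) chilbert_space ..

lemma ell2_nth_scaleC [simp]: "ell2_nth (scaleC c z) k = scaleC c (ell2_nth z k)"
  by (simp add: scaleC_ell2.rep_eq)

lemma has_sum_cinner_ell2: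
  "((\<lambda>k. cinner (ell2_nth y k) (ell2_nth z k)) has_sum cinner y z) UNIV"
  unfolding cinner_ell2.rep_eq
  by (intro has_sum_infsum summable_on_cinner square_summable_ell2_nth)

definition ell2_unit :: "'i \<Rightarrow> ('i, complex) ell2" where
  "ell2_unit i = ell2_of (\<lambda>k. if k = i then 1 else 0)"

lemma ell2_nth_unit: "ell2_nth (ell2_unit i) k = (if k = i then 1 else 0)"
proof -
  have "(\<lambda>k. (cmod (if k = i then 1 else 0))\<^sup>2) summable_on UNIV"
    by (rule finite_nonzero_values_imp_summable_on) (auto intro: finite_subset[of _ "{i}"])
  then show ?thesis by (simp add: ell2_unit_def ell2_nth_of square_summable_def)
qed

lift_definition ell2_tensor :: "('i, complex) ell2 \<Rightarrow> 'a \<Rightarrow> ('i, 'a::complex_inner) ell2"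
  (infixl "\<otimes>" 70)
  is "\<lambda>f x k. scaleC (f k) x"
  by (rule square_summable_rescale[of _ "norm _"]) (auto simp: norm_scaleC mult.commute)

lemma ell2_nth_tensor [simp]: "ell2_nth (f \<otimes> x) k = scaleC (ell2_nth f k) x"
  by (simp add: ell2_tensor.rep_eq)

lemma ell2_nth_tensor_unit: "ell2_nth (ell2_unit i \<otimes> x) k = (if k = i then x else 0)"
  by (simp add: ell2_nth_unit scaleC.zero_left)

lemma norm_ell2_tensor: "norm (f \<otimes> x) = norm f * norm x"
  by transfer (simp add: l2_norm_rescale[of _ "norm _"] norm_scaleC mult.commute)

interpretation ell2_tensor: bounded_bilinear
  "ell2_tensor :: ('i, complex) ell2 \<Rightarrow> 'a \<Rightarrow> ('i, 'a::complex_inner) ell2"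
proof
  show "\<exists>K. \<forall>(f :: ('i, complex) ell2) (x::'a). norm (f \<otimes> x) \<le> norm f * norm x * K"
    by (intro exI[of _ 1]) (simp add: norm_ell2_tensor)
qed (auto intro!: ell2_eqI simp: scaleC_add_left scaleC_add_right scaleC.scaleR_left
    scaleC.scaleR_right)

lift_definition ell2_slice :: "'a \<Rightarrow> ('i, 'a::complex_inner) ell2 \<Rightarrow> ('i, complex) ell2"
  is "\<lambda>w z k. cinner w (z k)"
proof -
  fix w :: 'a and z :: "'i \<Rightarrow> 'a" assume z: "square_summable z"
  show "square_summable (\<lambda>k. cinner w (z k))"
  proof (rule l2_norm_bound)
    fix F :: "'i set" assume F: "finite F"
    have "L2_set (\<lambda>k. cmod (cinner w (z k))) F \<le> norm w * L2_set (\<lambda>k. norm (z k)) F"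
      unfolding L2_set_right_distrib[OF norm_ge_zero] by (intro L2_set_mono norm_cinner_le) simp
    also have "\<dots> \<le> norm w * l2_norm z" by (intro mult_left_mono L2_set_le_l2_norm z F) simp
    finally show "L2_set (\<lambda>k. cmod (cinner w (z k))) F \<le> norm w * l2_norm z" .
  qed
qed

lemma ell2_nth_slice [simp]: "ell2_nth (ell2_slice w z) k = cinner w (ell2_nth z k)"
  by (simp add: ell2_slice.rep_eq)

lemma cinner_ell2_tensor: "cinner (f \<otimes> w) z = cinner f (ell2_slice w z)"
  by transfer (simp add: cinner_scaleC_left cinner_complex_def)

lemma ell2_slice_diff: "ell2_slice w (y - z) = ell2_slice w y - ell2_slice w z"
  by (rule ell2_eqI) (simp add: cinner.diff_right)

lemma ell2_slice_sum: "ell2_slice w (\<Sum>i\<in>M. z i) = (\<Sum>i\<in>M. ell2_slice w (z i))"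
  by (rule ell2_eqI) (simp add: ell2_nth_sum cinner.sum_right)

lemma ell2_slice_tensor: "ell2_slice w (f \<otimes> x) = scaleC (cinner w x) f"
  by (rule ell2_eqI) (simp add: cinner_scaleC_right scaleC_complex_def mult.commute)

text \<open>If \<open>P\<close> denotes the projection onto \<open>E\<close>, then \<open>P \<otimes> 1\<close> fixes \<open>z\<close> and maps \<open>f i \<otimes> w i\<close> to
  \<open>p i \<otimes> w i\<close>.\<close>

lemma norm_diff_projected_tensors_le:
  fixes z :: "('i, 'a::complex_inner) ell2"
  assumes E: "csubspace E" and z: "\<And>w. ell2_slice w z \<in> E"
    and p: "\<And>i. p i \<in> E" and orth: "\<And>i s. s \<in> E \<Longrightarrow> cinner s (f i - p i) = 0"
  shows "norm (z - (\<Sum>i\<in>M. p i \<otimes> w i)) \<le> norm (z - (\<Sum>i\<in>M. f i \<otimes> w i))"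
proof -
  define d where "d = z - (\<Sum>i\<in>M. p i \<otimes> w i)"
  define r where "r = (\<Sum>i\<in>M. (f i - p i) \<otimes> w i)"
  have slice_d: "ell2_slice x d \<in> E" for x
    unfolding d_def ell2_slice_diff ell2_slice_sum ell2_slice_tensor
    using E z p by (auto simp: csubspace_def intro!: subspace_diff subspace_sum)
  have "cinner r d = (\<Sum>i\<in>M. cinner (f i - p i) (ell2_slice (w i) d))"
    by (simp add: r_def cinner.sum_left cinner_ell2_tensor)
  also have "\<dots> = 0"
    using orth[OF slice_d] by (intro sum.neutral) (metis cinner_commute complex_cnj_zero)
  finally have "cinner d r = 0" by (metis cinner_commute complex_cnj_zero)
  then have "(norm d)\<^sup>2 \<le> (norm (d + - r))\<^sup>2"
    unfolding norm_add_square by (simp add: cinner.minus_right)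
  then have "norm d \<le> norm (d + - r)" by (rule power2_le_imp_le) simp
  also have "d + - r = z - (\<Sum>i\<in>M. f i \<otimes> w i)"
    by (simp add: d_def r_def ell2_tensor.diff_left sum_subtractf)
  finally show ?thesis by (simp add: d_def)
qed

section \<open>Rows and columns of operators\<close>

definition square_bounded ::
    "('i \<Rightarrow> 'a::real_normed_vector \<Rightarrow> 'b::real_normed_vector) \<Rightarrow> 'i set \<Rightarrow> real \<Rightarrow> bool" where
  "square_bounded T K \<beta> \<longleftrightarrow>
    (\<forall>F x. finite F \<longrightarrow> F \<subseteq> K \<longrightarrow> L2_set (\<lambda>k. norm (T k x)) F \<le> \<beta> * norm x)"

text \<open>Rows and columns are meaningful only for square-bounded families. The row \<open>z \<mapsto> \<Sum>\<^sub>k a\<^sub>k z\<^sub>k\<close> is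
  defined as an adjoint, so that this series is only needed in the weak sense.\<close>

definition column_op ::
    "('i \<Rightarrow> 'a \<Rightarrow> 'b::real_normed_vector) \<Rightarrow> 'a::real_normed_vector \<Rightarrow> ('i, 'b) ell2" where
  "column_op T x = ell2_of (\<lambda>k. T k x)"

definition row_op ::
    "('i \<Rightarrow> 'a::complex_inner \<Rightarrow> 'b::chilbert_space) \<Rightarrow> ('i, 'a) ell2 \<Rightarrow> 'b" where
  "row_op a = cadjoint (column_op (\<lambda>k. cadjoint (a k)))"

lemma square_bounded_mono:
  "square_bounded T K \<beta> \<Longrightarrow> \<beta> \<le> \<gamma> \<Longrightarrow> square_bounded T K \<gamma>"
  unfolding square_bounded_def by (meson mult_right_mono norm_ge_zero order_trans)

lemma ell2_nth_column:
  assumes "square_bounded T UNIV \<beta>"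
  shows "ell2_nth (column_op T x) k = T k x"
proof -
  have "square_summable (\<lambda>k. T k x)"
    by (rule l2_norm_bound) (use assms in \<open>auto simp: square_bounded_def\<close>)
  then show ?thesis by (simp add: column_op_def ell2_nth_of)
qed

lemma norm_column_le:
  assumes "square_bounded T UNIV \<beta>"
  shows "norm (column_op T x) \<le> \<beta> * norm x"
  by (rule norm_ell2_le) (use assms in \<open>simp add: ell2_nth_column square_bounded_def\<close>)

lemma bounded_clinear_column:
  assumes "square_bounded T UNIV \<beta>" and "\<And>k. bounded_clinear (T k)"
  shows "bounded_clinear (column_op T)"
proof -
  interpret T: bounded_clinear "T k" for k by fact
  show ?thesis
  proof
    show "\<exists>K. \<forall>x. norm (column_op T x) \<le> norm x * K"
      using norm_column_le[OF assms(1)] by (intro exI[of _ \<beta>]) (simp add: mult.commute)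
  qed (auto intro!: ell2_eqI simp: ell2_nth_column[OF assms(1)] T.add T.scaleR T.scaleC)
qed

definition slice ::
    "('i \<Rightarrow> 'a::complex_inner \<Rightarrow> 'b::complex_inner) \<Rightarrow> 'b \<Rightarrow> 'a \<Rightarrow> ('i, complex) ell2" where
  "slice b \<eta> y = ell2_slice \<eta> (column_op b y)"

definition slice_space ::
    "('i \<Rightarrow> 'a::complex_inner \<Rightarrow> 'b::complex_inner) \<Rightarrow> ('i, complex) ell2 set" where
  "slice_space b = closure (span (range (\<lambda>(\<eta>, y). slice b \<eta> y)))"

locale row_column =
  fixes a :: "'i \<Rightarrow> 'b::chilbert_space \<Rightarrow> 'c::chilbert_space"
    and b :: "'i \<Rightarrow> 'a::chilbert_space \<Rightarrow> 'b"
    and \<alpha> \<beta> :: real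
  assumes a_clinear: "bounded_clinear (a k)"
    and b_clinear: "bounded_clinear (b k)"
    and \<alpha>_nonneg: "0 \<le> \<alpha>"
    and row_bounded: "square_bounded (\<lambda>k. cadjoint (a k)) UNIV \<alpha>"
    and column_bounded: "square_bounded b UNIV \<beta>"
    and column_convergent: "0 < e \<Longrightarrow> \<exists>M. finite M \<and> square_bounded b (- M) e"
begin

lemma cinner_row: "cinner x (row_op a z) = cinner (column_op (\<lambda>k. cadjoint (a k)) x) z"
  unfolding row_op_def
  by (intro cinner_cadjoint bounded_clinear_column[OF row_bounded] bounded_clinear_cadjoint
      a_clinear)

lemma has_sum_cinner_row: "((\<lambda>k. cinner x (a k (ell2_nth z k))) has_sum cinner x (row_op a z)) UNIV"
  using has_sum_cinner_ell2[of "column_op (\<lambda>k. cadjoint (a k)) x" z]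
  by (simp add: cinner_row ell2_nth_column[OF row_bounded] cinner_cadjoint_left[OF a_clinear])

sublocale row: bounded_clinear "row_op a"
  unfolding row_op_def
  by (intro bounded_clinear_cadjoint bounded_clinear_column[OF row_bounded] a_clinear)

lemma norm_row_le: "norm (row_op a z) \<le> \<alpha> * norm z"
  unfolding row_op_def
  by (intro norm_cadjoint_le \<alpha>_nonneg norm_column_le[OF row_bounded]
      bounded_clinear_column[OF row_bounded] bounded_clinear_cadjoint a_clinear)

lemma nth_slice: "ell2_nth (slice b \<eta> y) k = cinner \<eta> (b k y)"
  by (simp add: slice_def ell2_nth_column[OF column_bounded])

lemma closed_slice_space: "closed (slice_space b)"
  by (simp add: slice_space_def)

lemma slice_in_slice_space: "slice b \<eta> y \<in> slice_space b"
  unfolding slice_space_def by (intro subsetD[OF closure_subset] span_base) auto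

lemma csubspace_slice_space: "csubspace (slice_space b)"
  unfolding slice_space_def
proof (intro csubspace_closure csubspace_span)
  fix c f assume "f \<in> range (\<lambda>(\<eta>, y). slice b \<eta> y)"
  then obtain \<eta> y where "f = slice b \<eta> y" by auto
  then have "scaleC c f = slice b (scaleC (cnj c) \<eta>) y"
    by (auto intro!: ell2_eqI simp: nth_slice cinner_scaleC_left scaleC_complex_def)
  then show "scaleC c f \<in> range (\<lambda>(\<eta>, y). slice b \<eta> y)" by auto
qed

lemma slice_space_subset:
  assumes "closed Z" "subspace Z" "\<And>\<eta> y. slice b \<eta> y \<in> Z"
  shows "slice_space b \<subseteq> Z"
  unfolding slice_space_def
  using assms by (intro closure_minimal span_minimal) auto

lemma column_approximation:
  assumes "0 < e"
  obtains M p where "finite M" and "\<And>i. p i \<in> slice_space b"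
    and "\<And>v. norm (column_op b v - (\<Sum>i\<in>M. p i \<otimes> b i v)) \<le> e * norm v"
proof -
  obtain M where M: "finite M" "square_bounded b (- M) e"
    using column_convergent[OF assms] by blast
  have "\<exists>p\<in>slice_space b. \<forall>s\<in>slice_space b. cinner s (ell2_unit i - p) = 0" for i
    by (rule orthogonal_projection_exists[OF closed_slice_space csubspace_slice_space]) blast
  then obtain p where p: "\<And>i. p i \<in> slice_space b"
    "\<And>i s. s \<in> slice_space b \<Longrightarrow> cinner s (ell2_unit i - p i) = 0"
    by metis
  have "norm (column_op b v - (\<Sum>i\<in>M. p i \<otimes> b i v)) \<le> e * norm v" for v
  proof -
    let ?tail = "column_op b v - (\<Sum>i\<in>M. ell2_unit i \<otimes> b i v)"
    have nth_tail: "ell2_nth ?tail k = (if k \<in> M then 0 else b k v)" for k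
      using M(1) by (simp add: ell2_nth_column[OF column_bounded] ell2_nth_sum
          ell2_nth_tensor_unit del: ell2_nth_tensor)
    have "norm (column_op b v - (\<Sum>i\<in>M. p i \<otimes> b i v)) \<le> norm ?tail"
      by (rule norm_diff_projected_tensors_le[OF csubspace_slice_space _ p])
        (simp add: slice_in_slice_space flip: slice_def)
    also have "norm ?tail \<le> e * norm v"
    proof (rule norm_ell2_le)
      fix F :: "'i set" assume F: "finite F"
      have "L2_set (\<lambda>k. norm (ell2_nth ?tail k)) F = L2_set (\<lambda>k. norm (b k v)) (F - M)"
        unfolding L2_set_def nth_tail
        by (intro arg_cong[of _ _ sqrt] sum.mono_neutral_cong_right F) auto
      also have "\<dots> \<le> e * norm v" using M(2) F by (auto simp: square_bounded_def)
      finally show "L2_set (\<lambda>k. norm (ell2_nth ?tail k)) F \<le> e * norm v" .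
    qed
    finally show ?thesis .
  qed
  then show ?thesis using that M(1) p(1) by blast
qed

lemma norm_row_column_approximation:
  assumes "norm (column_op b v - z) \<le> e * norm v"
  shows "norm (row_op a (column_op b v) - row_op a z) \<le> \<alpha> * e * norm v"
proof -
  have "norm (row_op a (column_op b v - z)) \<le> \<alpha> * (e * norm v)"
    by (rule order_trans[OF norm_row_le mult_left_mono[OF assms \<alpha>_nonneg]])
  then show ?thesis by (simp add: row.diff mult.assoc)
qed

lemma row_tensor_eq_0_on_slice_space:
  assumes "\<And>\<eta> y x. row_op a (slice b \<eta> y \<otimes> x) = 0" and "f \<in> slice_space b"
  shows "row_op a (f \<otimes> x) = 0"
proof -
  have "slice_space b \<subseteq> {f. \<forall>x. row_op a (f \<otimes> x) = 0}"
  proof (rule slice_space_subset)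
    show "closed {f. \<forall>x. row_op a (f \<otimes> x) = 0}"
      by (intro closed_Collect_all closed_Collect_eq continuous_on_const linear_continuous_on
          bounded_linear_compose[OF row.bounded_linear_axioms ell2_tensor.bounded_linear_left])
    show "subspace {f. \<forall>x. row_op a (f \<otimes> x) = 0}"
      by (simp add: subspace_def ell2_tensor.zero_left ell2_tensor.add_left ell2_tensor.scaleR_left
          row.zero row.add row.scaleR)
  qed (use assms(1) in simp)
  then show ?thesis using assms(2) by blast
qed

lemma row_column_eq_0:
  assumes "\<And>\<eta> y x. row_op a (slice b \<eta> y \<otimes> x) = 0"
  shows "row_op a (column_op b v) = 0"
proof -
  have "norm (row_op a (column_op b v)) \<le> e" if "0 < e" for e
  proof -
    define d where "d = e / (\<alpha> * norm v + 1)"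
    have pos: "0 < \<alpha> * norm v + 1" using \<alpha>_nonneg by (simp add: add_nonneg_pos)
    then have "0 < d" using that by (simp add: d_def)
    then obtain M p where p: "\<And>i. p i \<in> slice_space b"
      and "norm (column_op b v - (\<Sum>i\<in>M. p i \<otimes> b i v)) \<le> d * norm v"
      using column_approximation[of d] by metis
    from norm_row_column_approximation[OF this(2)]
    have "norm (row_op a (column_op b v)) \<le> \<alpha> * d * norm v"
      by (simp add: row.sum row_tensor_eq_0_on_slice_space[OF assms p])
    also have "\<alpha> * d * norm v = d * (\<alpha> * norm v + 1) - d" by (simp add: algebra_simps)
    also have "\<dots> = e - d" using pos by (simp add: d_def)
    also have "\<dots> \<le> e" using \<open>0 < d\<close> by simp
    finally show ?thesis .
  qed
  then show ?thesis using field_le_epsilon[of "norm (row_op a (column_op b v))" 0] by simp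
qed

end

section \<open>Compact right multipliers\<close>

definition vanishes_on :: "('b::complex_inner \<times> 'a) set \<Rightarrow> ('a \<Rightarrow> 'b) \<Rightarrow> bool" where
  "vanishes_on \<Phi> T \<longleftrightarrow> (\<forall>(\<zeta>, y)\<in>\<Phi>. cinner \<zeta> (T y) = 0)"

text \<open>These are the \<open>R\<close> for which \<open>T \<mapsto> T \<circ> R\<close> is a compact operator on \<open>A\<close>.\<close>

definition compact_multipliers ::
    "('b::complex_inner \<Rightarrow> 'c::complex_inner) set \<Rightarrow> ('a::real_normed_vector \<Rightarrow> 'b) set" where
  "compact_multipliers A = {R. \<forall>e>0. \<exists>\<Phi>. finite \<Phi> \<and>
     (\<forall>T\<in>A. vanishes_on \<Phi> T \<longrightarrow> (\<forall>x. norm (T (R x)) \<le> e * onorm T * norm x))}"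

lemma compact_multipliersE:
  assumes "R \<in> compact_multipliers A" "0 < e"
  obtains \<Phi> where "finite \<Phi>"
    and "\<And>T x. T \<in> A \<Longrightarrow> vanishes_on \<Phi> T \<Longrightarrow> norm (T (R x)) \<le> e * onorm T * norm x"
proof -
  obtain \<Phi> where "finite \<Phi>"
    "\<forall>T\<in>A. vanishes_on \<Phi> T \<longrightarrow> (\<forall>x. norm (T (R x)) \<le> e * onorm T * norm x)"
    using assms unfolding compact_multipliers_def by auto
  then show ?thesis using that by blast
qed

lemma compact_multipliers_limit:
  assumes A: "A \<subseteq> Collect bounded_linear"
    and approx: "\<And>e. 0 < e \<Longrightarrow> \<exists>S\<in>compact_multipliers A. \<forall>x. norm (R x - S x) \<le> e * norm x"
  shows "R \<in> compact_multipliers A"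
  unfolding compact_multipliers_def
proof safe
  fix e :: real assume "0 < e"
  then obtain S where S: "S \<in> compact_multipliers A" "\<And>x. norm (R x - S x) \<le> e / 2 * norm x"
    using approx[of "e / 2"] by auto
  obtain \<Phi> where \<Phi>: "finite \<Phi>" "\<And>T x. T \<in> A \<Longrightarrow> vanishes_on \<Phi> T \<Longrightarrow>
      norm (T (S x)) \<le> e / 2 * onorm T * norm x"
    using compact_multipliersE[OF S(1), of "e / 2"] \<open>0 < e\<close> by auto
  have "norm (T (R x)) \<le> e * onorm T * norm x"
    if T: "T \<in> A" "vanishes_on \<Phi> T" for T x
  proof -
    interpret T: bounded_linear T using A T(1) by blast
    have "norm (T (R x - S x)) \<le> onorm T * (e / 2 * norm x)"
      by (rule order_trans[OF onorm[OF T.bounded_linear_axioms] mult_left_mono[OF S(2)]])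
        (rule onorm_pos_le[OF T.bounded_linear_axioms])
    moreover have "norm (T (R x)) \<le> norm (T (R x - S x)) + norm (T (S x))"
      using norm_triangle_ineq[of "T (R x - S x)" "T (S x)"] by (simp add: T.diff)
    ultimately show ?thesis using \<Phi>(2)[OF T, of x] by (simp add: algebra_simps)
  qed
  then show "\<exists>\<Phi>. finite \<Phi> \<and> (\<forall>T\<in>A. vanishes_on \<Phi> T \<longrightarrow>
      (\<forall>x. norm (T (R x)) \<le> e * onorm T * norm x))"
    using \<Phi>(1) by blast
qed

lemma compact_multipliers_zero:
  assumes "A \<subseteq> Collect bounded_linear"
  shows "(\<lambda>x::'a::real_normed_vector. 0) \<in> compact_multipliers A"
proof -
  have "norm (T 0) \<le> e * onorm T * norm x" if "T \<in> A" "0 < e" for T e and x :: 'a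
  proof -
    have T: "bounded_linear T" using assms that(1) by blast
    then show ?thesis
      using that(2) onorm_pos_le[OF T] by (simp add: linear_0 bounded_linear.linear)
  qed
  then show ?thesis unfolding compact_multipliers_def by blast
qed

lemma compact_multipliers_add:
  assumes A: "A \<subseteq> Collect bounded_linear"
    and R: "R \<in> compact_multipliers A" and S: "S \<in> compact_multipliers A"
  shows "(\<lambda>x. R x + S x) \<in> compact_multipliers A"
  unfolding compact_multipliers_def
proof safe
  fix e :: real assume "0 < e"
  then have e: "0 < e / 2" by simp
  obtain \<Phi> where \<Phi>: "finite \<Phi>" "\<And>T x. T \<in> A \<Longrightarrow> vanishes_on \<Phi> T \<Longrightarrow>
      norm (T (R x)) \<le> e / 2 * onorm T * norm x"
    using compact_multipliersE[OF R e] by blast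
  obtain \<Psi> where \<Psi>: "finite \<Psi>" "\<And>T x. T \<in> A \<Longrightarrow> vanishes_on \<Psi> T \<Longrightarrow>
      norm (T (S x)) \<le> e / 2 * onorm T * norm x"
    using compact_multipliersE[OF S e] by blast
  have "norm (T (R x + S x)) \<le> e * onorm T * norm x"
    if T: "T \<in> A" "vanishes_on (\<Phi> \<union> \<Psi>) T" for T x
  proof -
    have "bounded_linear T" using A T(1) by blast
    then have "norm (T (R x + S x)) \<le> norm (T (R x)) + norm (T (S x))"
      using norm_triangle_ineq[of "T (R x)" "T (S x)"]
      by (simp add: linear_add bounded_linear.linear)
    also have "\<dots> \<le> e / 2 * onorm T * norm x + e / 2 * onorm T * norm x"
      using T by (intro add_mono \<Phi>(2) \<Psi>(2)) (auto simp: vanishes_on_def)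
    finally show ?thesis by simp
  qed
  then show "\<exists>\<Phi>. finite \<Phi> \<and> (\<forall>T\<in>A. vanishes_on \<Phi> T \<longrightarrow>
      (\<forall>x. norm (T (R x + S x)) \<le> e * onorm T * norm x))"
    using \<Phi>(1) \<Psi>(1) by (intro exI[of _ "\<Phi> \<union> \<Psi>"]) blast
qed

lemma compact_multipliers_sum:
  assumes "A \<subseteq> Collect bounded_linear" and "\<And>i. i \<in> M \<Longrightarrow> R i \<in> compact_multipliers A"
  shows "(\<lambda>x. \<Sum>i\<in>M. R i x) \<in> compact_multipliers A"
  using assms(2)
  by (induction M rule: infinite_finite_induct)
    (simp_all add: compact_multipliers_zero compact_multipliers_add assms(1))

lemma compact_multipliers_compose:
  assumes A: "A \<subseteq> Collect bounded_linear"
    and R: "R \<in> compact_multipliers A" and S: "bounded_linear S"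
  shows "(\<lambda>x. R (S x)) \<in> compact_multipliers A"
  unfolding compact_multipliers_def
proof safe
  fix e :: real assume "0 < e"
  obtain K where K: "0 < K" "\<And>x. norm (S x) \<le> norm x * K"
    using bounded_linear.pos_bounded[OF S] by blast
  obtain \<Phi> where \<Phi>: "finite \<Phi>" "\<And>T x. T \<in> A \<Longrightarrow> vanishes_on \<Phi> T \<Longrightarrow>
      norm (T (R x)) \<le> e / K * onorm T * norm x"
    using compact_multipliersE[OF R, of "e / K"] \<open>0 < e\<close> K(1) by auto
  have "norm (T (R (S x))) \<le> e * onorm T * norm x"
    if T: "T \<in> A" "vanishes_on \<Phi> T" for T x
  proof -
    have "0 \<le> onorm T" using A T(1) by (intro onorm_pos_le) blast
    then have "norm (T (R (S x))) \<le> e / K * onorm T * (norm x * K)"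
      using \<open>0 < e\<close> K by (intro order_trans[OF \<Phi>(2)[OF T] mult_left_mono]) auto
    then show ?thesis using K(1) by simp
  qed
  then show "\<exists>\<Phi>. finite \<Phi> \<and> (\<forall>T\<in>A. vanishes_on \<Phi> T \<longrightarrow>
      (\<forall>x. norm (T (R (S x))) \<le> e * onorm T * norm x))"
    using \<Phi>(1) by blast
qed

context row_column
begin

lemma closed_compact_row_tensors:
  assumes A: "A \<subseteq> Collect bounded_linear"
  shows "closed {f. (\<lambda>x. row_op a (f \<otimes> x)) \<in> compact_multipliers A}" (is "closed ?Z")
proof (rule closure_subset_eq[THEN iffD1], rule subsetI)
  fix f assume f: "f \<in> closure ?Z"
  have "\<exists>S\<in>compact_multipliers A. \<forall>x. norm (row_op a (f \<otimes> x) - S x) \<le> e * norm x"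
    if "0 < e" for e
  proof -
    have "0 < e / (\<alpha> + 1)" using that \<alpha>_nonneg by simp
    then obtain g where g: "g \<in> ?Z" "dist g f < e / (\<alpha> + 1)"
      using f unfolding closure_approachable by blast
    have "norm (row_op a (f \<otimes> x) - row_op a (g \<otimes> x)) \<le> e * norm x" for x
    proof -
      have "norm (row_op a ((f - g) \<otimes> x)) \<le> \<alpha> * (norm (f - g) * norm x)"
        using norm_row_le[of "(f - g) \<otimes> x"] by (simp add: norm_ell2_tensor)
      also have "\<dots> \<le> (\<alpha> + 1) * (e / (\<alpha> + 1) * norm x)"
        using g(2) \<alpha>_nonneg
        by (intro mult_mono mult_right_mono) (auto simp: dist_norm norm_minus_commute)
      also have "\<dots> = e * norm x" using \<alpha>_nonneg by simp
      finally show ?thesis by (simp add: ell2_tensor.diff_left row.diff)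
    qed
    then show ?thesis
      using g(1) by (intro bexI[where x = "\<lambda>x. row_op a (g \<otimes> x)"]) auto
  qed
  then show "f \<in> ?Z" unfolding mem_Collect_eq by (rule compact_multipliers_limit[OF A])
qed

lemma compact_multipliers_slice_space:
  assumes A: "A \<subseteq> Collect bounded_linear"
    and slices: "\<And>\<eta> y. (\<lambda>x. row_op a (slice b \<eta> y \<otimes> x)) \<in> compact_multipliers A"
    and f: "f \<in> slice_space b"
  shows "(\<lambda>x. row_op a (f \<otimes> x)) \<in> compact_multipliers A"
proof -
  define Z where "Z = {f. (\<lambda>x. row_op a (f \<otimes> x)) \<in> compact_multipliers A}"
  have "slice_space b \<subseteq> Z"
  proof (rule slice_space_subset)
    show "subspace Z"
      unfolding subspace_def
    proof (intro conjI ballI allI)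
      show "c *\<^sub>R f \<in> Z" if "f \<in> Z" for c f
        using compact_multipliers_compose[OF A _ bounded_linear_scaleR_right[of c],
            of "\<lambda>x. row_op a (f \<otimes> x)"] that
        by (simp add: Z_def ell2_tensor.scaleR_left ell2_tensor.scaleR_right)
    qed (simp_all add: Z_def ell2_tensor.zero_left ell2_tensor.add_left row.zero row.add
        compact_multipliers_zero compact_multipliers_add A)
  qed (simp_all add: Z_def slices closed_compact_row_tensors A)
  then show ?thesis using f by (auto simp: Z_def)
qed

lemma compact_multipliers_row_column:
  assumes A: "A \<subseteq> Collect bounded_linear"
    and slices: "\<And>\<eta> y. (\<lambda>x. row_op a (slice b \<eta> y \<otimes> x)) \<in> compact_multipliers A"
  shows "(\<lambda>v. row_op a (column_op b v)) \<in> compact_multipliers A"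
proof (rule compact_multipliers_limit[OF A])
  fix e :: real assume "0 < e"
  then have "0 < e / (\<alpha> + 1)" using \<alpha>_nonneg by simp
  then obtain M p where "finite M" and p: "\<And>i. p i \<in> slice_space b"
    and approx: "\<And>v. norm (column_op b v - (\<Sum>i\<in>M. p i \<otimes> b i v))
      \<le> e / (\<alpha> + 1) * norm v"
    using column_approximation by metis
  have "bounded_linear (b i)" for i
    using b_clinear by (simp add: bounded_clinear_def)
  then have "(\<lambda>v. \<Sum>i\<in>M. row_op a (p i \<otimes> b i v)) \<in> compact_multipliers A"
    by (intro compact_multipliers_sum compact_multipliers_slice_space[OF A slices p]
        compact_multipliers_compose[where R = "\<lambda>x. row_op a (_ \<otimes> x)"] A)
  moreover have "norm (row_op a (column_op b v) - (\<Sum>i\<in>M. row_op a (p i \<otimes> b i v)))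
      \<le> e * norm v" for v
  proof -
    have "\<alpha> * (e / (\<alpha> + 1)) \<le> e"
      using \<open>0 < e\<close> \<alpha>_nonneg by (simp add: field_simps)
    then have "\<alpha> * (e / (\<alpha> + 1)) * norm v \<le> e * norm v" by (rule mult_right_mono) simp
    then show ?thesis
      using norm_row_column_approximation[OF approx[of v]] by (simp add: row.sum)
  qed
  ultimately show "\<exists>S\<in>compact_multipliers A. \<forall>v. norm (row_op a (column_op b v) - S v) \<le> e * norm v"
    by (intro bexI[where x = "\<lambda>v. \<Sum>i\<in>M. row_op a (p i \<otimes> b i v)"]) auto
qed

end

section \<open>Criteria for finite dimension\<close>

lemma finite_dim_ops_if_finite_dim_kernel:
  assumes add: "\<And>S T. S \<in> A \<Longrightarrow> T \<in> A \<Longrightarrow> (\<lambda>x. S x + T x) \<in> A"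
    and scale: "\<And>c T. T \<in> A \<Longrightarrow> (\<lambda>x. scaleC c (T x)) \<in> A"
    and \<phi>_add: "\<And>S T. S \<in> A \<Longrightarrow> T \<in> A \<Longrightarrow> \<phi> (\<lambda>x. S x + T x) = \<phi> S + \<phi> T"
    and \<phi>_scale: "\<And>c T. T \<in> A \<Longrightarrow> \<phi> (\<lambda>x. scaleC c (T x)) = c * \<phi> T"
    and kernel: "finite_dim_ops {T \<in> A. \<phi> T = 0}"
  shows "finite_dim_ops A"
proof (cases "{T \<in> A. \<phi> T = 0} = A")
  case True
  then show ?thesis using kernel by simp
next
  case False
  then obtain T0 where T0: "T0 \<in> A" "\<phi> T0 \<noteq> 0" by blast
  obtain F where F: "finite F" "F \<subseteq> {T \<in> A. \<phi> T = 0}"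
    "\<And>T. T \<in> A \<Longrightarrow> \<phi> T = 0 \<Longrightarrow> \<exists>c. T = (\<lambda>x. \<Sum>f\<in>F. scaleC (c f) (f x))"
    using kernel unfolding finite_dim_ops_def by blast
  have "T0 \<notin> F" using F(2) T0(2) by blast
  have "\<exists>c. T = (\<lambda>x. \<Sum>f\<in>insert T0 F. scaleC (c f) (f x))" if T: "T \<in> A" for T
  proof -
    define k where "k = \<phi> T / \<phi> T0"
    define S where "S = (\<lambda>x. T x + scaleC (- k) (T0 x))"
    have "S \<in> A" "\<phi> S = 0"
      unfolding S_def
      using T T0 add scale \<phi>_add[OF T scale[OF T0(1)]] \<phi>_scale[OF T0(1)] by (simp_all add: k_def)
    then obtain c where c: "S = (\<lambda>x. \<Sum>f\<in>F. scaleC (c f) (f x))" using F(3) by blast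
    have "T x = (\<Sum>f\<in>insert T0 F. scaleC ((c(T0 := k)) f) (f x))" for x
    proof -
      have "(\<Sum>f\<in>F. scaleC ((c(T0 := k)) f) (f x)) = S x"
        unfolding c using \<open>T0 \<notin> F\<close> by (intro sum.cong) auto
      then show ?thesis using F(1) \<open>T0 \<notin> F\<close> by (simp add: S_def scaleC.minus_left)
    qed
    then show ?thesis by blast
  qed
  moreover have "finite (insert T0 F)" "insert T0 F \<subseteq> A" using F(1,2) T0(1) by auto
  ultimately show ?thesis unfolding finite_dim_ops_def by blast
qed

lemma finite_dim_ops_if_functionals_separate:
  assumes "finite J"
    and "\<And>S T. S \<in> A \<Longrightarrow> T \<in> A \<Longrightarrow> (\<lambda>x. S x + T x) \<in> A"
    and "\<And>c T. T \<in> A \<Longrightarrow> (\<lambda>x. scaleC c (T x)) \<in> A"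
    and "\<And>j S T. S \<in> A \<Longrightarrow> T \<in> A \<Longrightarrow> \<phi> j (\<lambda>x. S x + T x) = \<phi> j S + \<phi> j T"
    and "\<And>j c T. T \<in> A \<Longrightarrow> \<phi> j (\<lambda>x. scaleC c (T x)) = c * \<phi> j T"
    and "\<And>T. T \<in> A \<Longrightarrow> (\<And>j. j \<in> J \<Longrightarrow> \<phi> j T = 0) \<Longrightarrow> T = (\<lambda>x. 0)"
  shows "finite_dim_ops A"
  using assms
proof (induction J arbitrary: A rule: finite_induct)
  case empty
  then show ?case unfolding finite_dim_ops_def by (intro exI[of _ "{}"]) auto
next
  case (insert j J)
  note closed = insert.prems(1,2) and linear = insert.prems(3,4) and separating = insert.prems(5)
  have "finite_dim_ops {T \<in> A. \<phi> j T = 0}"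
  proof (rule insert.IH)
    show "T = (\<lambda>x. 0)" if "T \<in> {T \<in> A. \<phi> j T = 0}" "\<And>i. i \<in> J \<Longrightarrow> \<phi> i T = 0" for T
      by (rule separating) (use that in auto)
  qed (use closed linear in auto)
  then show ?case
    using finite_dim_ops_if_finite_dim_kernel[of A "\<phi> j"] closed linear by blast
qed

theorem finite_dim_ops_if_identity_compact:
  assumes A: "unital_subalgebra A" and "(\<lambda>x. x) \<in> compact_multipliers A"
  shows "finite_dim_ops A"
proof -
  obtain \<Phi> where \<Phi>: "finite \<Phi>" "\<And>T x. T \<in> A \<Longrightarrow> vanishes_on \<Phi> T \<Longrightarrow>
      norm (T x) \<le> 1/2 * onorm T * norm x"
    using compact_multipliersE[OF assms(2), of "1/2"] by auto
  show ?thesis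
  proof (rule finite_dim_ops_if_functionals_separate[OF \<Phi>(1),
        where \<phi> = "\<lambda>(\<zeta>, y) T. cinner \<zeta> (T y)"])
    fix T assume T: "T \<in> A" and "\<And>j. j \<in> \<Phi> \<Longrightarrow> (case j of (\<zeta>, y) \<Rightarrow> \<lambda>T. cinner \<zeta> (T y)) T = 0"
    then have "vanishes_on \<Phi> T" by (fastforce simp: vanishes_on_def)
    note small = \<Phi>(2)[OF T this]
    have bl: "bounded_linear T" using A T by (auto simp: unital_subalgebra_def bounded_ops_def)
    have "onorm T \<le> 1/2 * onorm T"
      using small onorm_pos_le[OF bl] by (intro onorm_bound) auto
    then have "onorm T = 0" using onorm_pos_le[OF bl] by simp
    then show "T = (\<lambda>x. 0)" using onorm_eq_0[OF bl] by auto
  qed (use A in \<open>auto simp: unital_subalgebra_def cinner_add_right cinner_scaleC_right\<close>)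
qed

section \<open>The Haagerup norm\<close>

lemma bounded_ops_iff: "T \<in> bounded_ops \<longleftrightarrow> bounded_clinear T"
  by (auto simp: bounded_ops_def bounded_clinear_def bounded_clinear_axioms_def)

lemma sum_list_conv_sum_nth: "(\<Sum>p\<leftarrow>L. f p) = (\<Sum>i<length L. f (L ! i))"
  by (simp add: sum_list_sum_nth atLeast0LessThan)

definition gram :: "('a::chilbert_space \<Rightarrow> 'b::chilbert_space) list \<Rightarrow> 'a \<Rightarrow> 'a" where
  "gram Ss x = (\<Sum>S\<leftarrow>Ss. cadjoint S (S x))"

lemma bounded_linear_gram:
  assumes "\<forall>S\<in>set Ss. bounded_clinear S"
  shows "bounded_linear (gram Ss)"
proof -
  have "bounded_linear (\<lambda>x. cadjoint S (S x))" if "S \<in> set Ss" for S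
    using assms that
    by (intro bounded_linear_compose[of "cadjoint S" S] bounded_clinear.axioms(1)
        bounded_clinear_cadjoint) auto
  then show ?thesis
    unfolding gram_def[abs_def] sum_list_conv_sum_nth by (intro bounded_linear_sum) auto
qed

lemma sum_norm_square_le_onorm_gram:
  assumes Ss: "\<forall>S\<in>set Ss. bounded_clinear S"
  shows "(\<Sum>S\<leftarrow>Ss. (norm (S x))\<^sup>2) \<le> onorm (gram Ss) * (norm x)\<^sup>2"
proof -
  have "cinner x (gram Ss x) = complex_of_real (\<Sum>S\<leftarrow>Ss. (norm (S x))\<^sup>2)"
    using Ss
    by (induction Ss)
      (simp_all add: gram_def cinner.zero_right cinner_add_right cinner_cadjoint cinner_self_norm)
  then have "(\<Sum>S\<leftarrow>Ss. (norm (S x))\<^sup>2) \<le> cmod (cinner x (gram Ss x))"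
    by simp
  also have "\<dots> \<le> norm x * norm (gram Ss x)" by (rule norm_cinner_le)
  also have "\<dots> \<le> norm x * (onorm (gram Ss) * norm x)"
    by (intro mult_left_mono onorm bounded_linear_gram Ss) simp
  finally show ?thesis by (simp add: power2_eq_square mult_ac)
qed

lemma onorm_gram_scaleR:
  assumes "\<forall>S\<in>set Ss. bounded_clinear S"
  shows "onorm (gram (map (\<lambda>S x. r *\<^sub>R S x) Ss)) = r\<^sup>2 * onorm (gram Ss)"
proof -
  have "cadjoint (\<lambda>x. r *\<^sub>R S x) (r *\<^sub>R S x) = r\<^sup>2 *\<^sub>R cadjoint S (S x)" if "S \<in> set Ss" for S x
  proof -
    have S: "bounded_clinear S" using assms that by blast
    interpret adj: bounded_clinear "cadjoint S" by (rule bounded_clinear_cadjoint[OF S])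
    show ?thesis by (simp add: cadjoint_scaleR[OF S] adj.scaleR power2_eq_square)
  qed
  then have "gram (map (\<lambda>S x. r *\<^sub>R S x) Ss) = (\<lambda>x. r\<^sup>2 *\<^sub>R gram Ss x)"
    by (induction Ss) (auto simp: gram_def fun_eq_iff scaleR_add_right)
  then show ?thesis by (simp add: onorm_scaleR bounded_linear_gram assms)
qed

lemma bounded_clinear_pair:
  assumes "set L \<subseteq> bounded_ops \<times> bounded_ops" "(a, b) \<in> set L"
  shows "bounded_clinear a" "bounded_clinear b"
  using assms unfolding bounded_ops_iff[symmetric] by auto

lemma row_fac_eq_gram:
  assumes "set L \<subseteq> bounded_ops \<times> bounded_ops"
  shows "row_fac L = sqrt (onorm (gram (map (\<lambda>(a, b). cadjoint a) L)))"
proof -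
  have "(\<Sum>(a, b)\<leftarrow>L. a (adj a x)) = gram (map (\<lambda>(a, b). cadjoint a) L) x" for x
    using bounded_clinear_pair(1)[OF assms]
    by (auto simp: gram_def adj_eq_cadjoint cadjoint_cadjoint intro!: arg_cong[of _ _ sum_list])
  then show ?thesis by (simp add: row_fac_def)
qed

lemma col_fac_eq_gram: "col_fac L = sqrt (onorm (gram (map snd L)))"
  by (simp add: col_fac_def gram_def[abs_def] adj_eq_cadjoint split_def o_def)

lemma
  assumes L: "set L \<subseteq> bounded_ops \<times> bounded_ops"
  shows row_fac_nonneg: "0 \<le> row_fac L"
    and sum_norm_cadjoint_le_row_fac:
      "(\<Sum>(a, b)\<leftarrow>L. (norm (cadjoint a x))\<^sup>2) \<le> (row_fac L * norm x)\<^sup>2"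
proof -
  let ?Ss = "map (\<lambda>(a, b). cadjoint a) L"
  have Ss: "\<forall>S\<in>set ?Ss. bounded_clinear S"
    using bounded_clinear_pair(1)[OF L] by (auto intro: bounded_clinear_cadjoint)
  have "0 \<le> onorm (gram ?Ss)" by (intro onorm_pos_le bounded_linear_gram Ss)
  then show "0 \<le> row_fac L"
    and "(\<Sum>(a, b)\<leftarrow>L. (norm (cadjoint a x))\<^sup>2) \<le> (row_fac L * norm x)\<^sup>2"
    using sum_norm_square_le_onorm_gram[OF Ss, of x]
    by (simp_all add: row_fac_eq_gram[OF L] power_mult_distrib split_def o_def)
qed

lemma
  assumes L: "set L \<subseteq> bounded_ops \<times> bounded_ops"
  shows col_fac_nonneg: "0 \<le> col_fac L"
    and sum_norm_le_col_fac: "(\<Sum>(a, b)\<leftarrow>L. (norm (b x))\<^sup>2) \<le> (col_fac L * norm x)\<^sup>2"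
proof -
  have Ss: "\<forall>S\<in>set (map snd L). bounded_clinear S"
    using bounded_clinear_pair(2)[OF L] by auto
  have "0 \<le> onorm (gram (map snd L))" by (intro onorm_pos_le bounded_linear_gram Ss)
  then show "0 \<le> col_fac L"
    and "(\<Sum>(a, b)\<leftarrow>L. (norm (b x))\<^sup>2) \<le> (col_fac L * norm x)\<^sup>2"
    using sum_norm_square_le_onorm_gram[OF Ss, of x]
    by (simp_all add: col_fac_eq_gram power_mult_distrib split_def o_def)
qed

lemma norm_tens_le:
  assumes L: "set L \<subseteq> bounded_ops \<times> bounded_ops"
  shows "cmod (tens L \<xi> x \<eta> y) \<le> row_fac L * col_fac L * (norm \<xi> * norm x * norm \<eta> * norm y)"
proof -
  define \<alpha> where "\<alpha> i = norm (cadjoint (fst (L ! i)) \<xi>)" for i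
  define \<beta> where "\<beta> i = norm (snd (L ! i) y)" for i
  have "cmod (tens L \<xi> x \<eta> y) \<le> (\<Sum>i<length L. \<bar>\<alpha> i\<bar> * \<bar>\<beta> i\<bar> * (norm x * norm \<eta>))"
    unfolding tens_def sum_list_conv_sum_nth split_def
  proof (rule sum_norm_le)
    fix i assume "i \<in> {..<length L}"
    then have "bounded_clinear (fst (L ! i))"
      using bounded_clinear_pair(1)[OF L, of "fst (L ! i)" "snd (L ! i)"] by simp
    then have "cmod (cinner \<xi> (fst (L ! i) x)) \<le> \<alpha> i * norm x"
      using norm_cinner_le[of "cadjoint (fst (L ! i)) \<xi>" x]
      by (simp add: \<alpha>_def cinner_cadjoint_left)
    moreover have "cmod (cinner \<eta> (snd (L ! i) y)) \<le> norm \<eta> * \<beta> i"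
      unfolding \<beta>_def by (rule norm_cinner_le)
    ultimately have "cmod (cinner \<xi> (fst (L ! i) x)) * cmod (cinner \<eta> (snd (L ! i) y))
        \<le> (\<alpha> i * norm x) * (norm \<eta> * \<beta> i)"
      by (intro mult_mono) (auto simp: \<alpha>_def)
    then show "cmod (cinner \<xi> (fst (L ! i) x) * cinner \<eta> (snd (L ! i) y))
        \<le> \<bar>\<alpha> i\<bar> * \<bar>\<beta> i\<bar> * (norm x * norm \<eta>)"
      by (simp add: norm_mult \<alpha>_def \<beta>_def mult_ac)
  qed
  also have "\<dots> \<le> L2_set \<alpha> {..<length L} * L2_set \<beta> {..<length L} * (norm x * norm \<eta>)"
    unfolding sum_distrib_right[symmetric] by (intro mult_right_mono L2_set_mult_ineq) simp
  also have "\<dots> \<le> (row_fac L * norm \<xi>) * (col_fac L * norm y) * (norm x * norm \<eta>)"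
  proof (intro mult_mono)
    show "L2_set \<alpha> {..<length L} \<le> row_fac L * norm \<xi>"
      "L2_set \<beta> {..<length L} \<le> col_fac L * norm y"
      using sum_norm_cadjoint_le_row_fac[OF L, of \<xi>] sum_norm_le_col_fac[OF L, of y]
        row_fac_nonneg[OF L] col_fac_nonneg[OF L]
      by (auto simp: L2_set_def \<alpha>_def \<beta>_def sum_list_conv_sum_nth split_def
          intro!: real_le_lsqrt sum_nonneg)
  qed (use row_fac_nonneg[OF L] col_fac_nonneg[OF L] in auto)
  finally show ?thesis by (simp add: mult_ac)
qed

lemma haagerup_norm_greatest:
  assumes "set L \<subseteq> A \<times> A"
    and "\<And>L'. set L' \<subseteq> A \<times> A \<Longrightarrow> tens L' = tens L \<Longrightarrow> c \<le> row_fac L' * col_fac L'"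
  shows "c \<le> haagerup_norm A L"
  unfolding haagerup_norm_def by (rule cInf_greatest) (use assms in auto)

lemma norm_tens_le_haagerup_norm:
  assumes A: "A \<subseteq> bounded_ops" and L: "set L \<subseteq> A \<times> A"
  shows "cmod (tens L \<xi> x \<eta> y) \<le> haagerup_norm A L * (norm \<xi> * norm x * norm \<eta> * norm y)"
    (is "_ \<le> _ * ?n")
proof -
  have bound: "cmod (tens L \<xi> x \<eta> y) \<le> row_fac L' * col_fac L' * ?n"
    if "set L' \<subseteq> A \<times> A" "tens L' = tens L" for L'
    using norm_tens_le[of L' \<xi> x \<eta> y] that A by (auto simp: subset_iff)
  show ?thesis
  proof (cases "?n = 0")
    case True
    show ?thesis using bound[OF L refl] unfolding True by simp
  next
    case False
    then have pos: "?n > 0" by (simp add: less_le)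
    then have "cmod (tens L \<xi> x \<eta> y) / ?n \<le> haagerup_norm A L"
      using bound by (intro haagerup_norm_greatest[OF L]) (simp add: pos_divide_le_eq)
    then show ?thesis using pos by (simp add: pos_divide_le_eq)
  qed
qed

definition rescale ::
    "real \<Rightarrow> (('b \<Rightarrow> 'c::real_vector) \<times> ('a \<Rightarrow> 'd::real_vector)) list \<Rightarrow>
      (('b \<Rightarrow> 'c) \<times> ('a \<Rightarrow> 'd)) list" where
  "rescale s L = map (\<lambda>(a, b). (\<lambda>x. s *\<^sub>R a x, \<lambda>x. b x /\<^sub>R s)) L"

lemma tens_rescale: "s \<noteq> 0 \<Longrightarrow> tens (rescale s L) = tens L"
  by (auto simp: tens_def rescale_def fun_eq_iff cinner.scaleR_right split_def o_def)

lemma row_fac_rescale: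
  assumes L: "set L \<subseteq> bounded_ops \<times> bounded_ops" and "0 \<le> s"
  shows "row_fac (rescale s L) = s * row_fac L"
proof -
  have Ss: "\<forall>S\<in>set (map (\<lambda>(a, b). cadjoint a) L). bounded_clinear S"
    using bounded_clinear_pair(1)[OF L] by (auto intro: bounded_clinear_cadjoint)
  have "set (rescale s L) \<subseteq> bounded_ops \<times> bounded_ops"
    using bounded_clinear_pair[OF L]
    by (auto simp: rescale_def bounded_ops_iff bounded_clinear_scaleR)
  moreover have "map (\<lambda>(a, b). cadjoint a) (rescale s L)
      = map (\<lambda>S x. s *\<^sub>R S x) (map (\<lambda>(a, b). cadjoint a) L)"
    using bounded_clinear_pair(1)[OF L] by (auto simp: rescale_def cadjoint_scaleR fun_eq_iff)
  ultimately show ?thesis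
    using \<open>0 \<le> s\<close>
    by (simp add: row_fac_eq_gram[OF L] row_fac_eq_gram onorm_gram_scaleR[OF Ss] real_sqrt_mult
        del: map_map)
qed

lemma col_fac_rescale:
  assumes L: "set L \<subseteq> bounded_ops \<times> bounded_ops" and "0 \<le> s"
  shows "col_fac (rescale s L) = col_fac L / s"
proof -
  have Ss: "\<forall>S\<in>set (map snd L). bounded_clinear S"
    using bounded_clinear_pair(2)[OF L] by auto
  have "map snd (rescale s L) = map (\<lambda>S x. inverse s *\<^sub>R S x) (map snd L)"
    by (simp add: rescale_def split_def o_def)
  then show ?thesis
    using \<open>0 \<le> s\<close>
    by (simp add: col_fac_eq_gram onorm_gram_scaleR[OF Ss] real_sqrt_mult divide_inverse
        mult.commute del: map_map)
qed

lemma ex_balancing_factor: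
  fixes p q t :: real
  assumes "0 \<le> p" "0 \<le> q" "0 < t" "p * q < t\<^sup>2"
  shows "\<exists>s>0. s * p \<le> t \<and> q / s \<le> t"
proof (cases "p = 0")
  case True
  have "q / ((q + 1) / t) \<le> t"
    using assms by (simp add: field_simps)
  then show ?thesis
    using assms True by (intro exI[of _ "(q + 1) / t"]) auto
next
  case False
  then show ?thesis
    using assms by (intro exI[of _ "t / p"]) (auto simp: field_simps power2_eq_square)
qed

lemma balanced_representation:
  assumes A: "unital_subalgebra A" and L: "set L \<subseteq> A \<times> A" and t: "0 < t"
    and "haagerup_norm A L < t\<^sup>2"
  obtains L' where "set L' \<subseteq> A \<times> A" "tens L' = tens L" "row_fac L' \<le> t" "col_fac L' \<le> t"
proof -
  have AB: "A \<subseteq> bounded_ops" and scale: "\<And>c T. T \<in> A \<Longrightarrow> (\<lambda>x. scaleC c (T x)) \<in> A"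
    using A by (auto simp: unital_subalgebra_def)
  obtain M where M: "set M \<subseteq> A \<times> A" "tens M = tens L" and lt: "row_fac M * col_fac M < t\<^sup>2"
    using haagerup_norm_greatest[OF L, of "t\<^sup>2"] assms(4) by (meson not_less)
  have MB: "set M \<subseteq> bounded_ops \<times> bounded_ops" using M(1) AB by blast
  obtain s where s: "0 < s" "s * row_fac M \<le> t" "col_fac M / s \<le> t"
    using ex_balancing_factor[OF row_fac_nonneg[OF MB] col_fac_nonneg[OF MB] t lt] by blast
  have "(\<lambda>x. r *\<^sub>R T x) \<in> A" if "T \<in> A" for T and r :: real
    using scale[OF that, of "of_real r"] by (simp add: scaleC_of_real)
  then have "set (rescale s M) \<subseteq> A \<times> A" using M(1) by (auto simp: rescale_def)
  then show ?thesis
    using that[of "rescale s M"] s M(2)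
    by (simp add: tens_rescale row_fac_rescale[OF MB] col_fac_rescale[OF MB])
qed

section \<open>Square-summable representations\<close>

definition block ::
    "(nat \<Rightarrow> (('b \<Rightarrow> 'c::zero) \<times> ('a \<Rightarrow> 'd::zero)) list) \<Rightarrow> nat \<times> nat \<Rightarrow> ('b \<Rightarrow> 'c) \<times> ('a \<Rightarrow> 'd)" where
  "block L = (\<lambda>(j, i). nth_default (\<lambda>_. 0, \<lambda>_. 0) (L j) i)"

lemma has_sum_nth_default:
  assumes "\<phi> d = 0"
  shows "((\<lambda>i. \<phi> (nth_default d L i)) has_sum (\<Sum>p\<leftarrow>L. \<phi> p)) UNIV"
proof (rule has_sum_finite_neutralI[of "{..<length L}"])
  show "(\<Sum>p\<leftarrow>L. \<phi> p) = (\<Sum>i<length L. \<phi> (nth_default d L i))"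
    unfolding sum_list_conv_sum_nth by (rule sum.cong) (auto simp: nth_default_def)
qed (auto simp: nth_default_def assms)

lemma sums_block:
  assumes "((\<lambda>k. \<phi> (block L k)) has_sum s) UNIV"
    and "\<phi> (\<lambda>_. 0, \<lambda>_. 0) = (0 :: complex)"
  shows "(\<lambda>j. \<Sum>p\<leftarrow>L j. \<phi> p) sums s"
proof (rule has_sum_imp_sums, rule has_sum_SigmaD)
  show "((\<lambda>k. \<phi> (block L k)) has_sum s) (Sigma UNIV (\<lambda>_. UNIV))"
    using assms(1) by simp
  show "((\<lambda>i. \<phi> (block L (j, i))) has_sum (\<Sum>p\<leftarrow>L j. \<phi> p)) UNIV" for j
    unfolding block_def prod.case using assms(2) by (rule has_sum_nth_default)
qed

lemma sum_block_le:
  fixes \<phi> :: "('b \<Rightarrow> 'c::zero) \<times> ('a \<Rightarrow> 'd::zero) \<Rightarrow> real"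
  assumes F: "finite F" "\<And>j i. (j, i) \<in> F \<Longrightarrow> i < length (L j) \<Longrightarrow> J \<le> j"
    and \<phi>: "\<And>p. 0 \<le> \<phi> p" "\<phi> (\<lambda>_. 0, \<lambda>_. 0) = 0"
  obtains m where "(\<Sum>k\<in>F. \<phi> (block L k)) \<le> (\<Sum>j=J..<J + m. \<Sum>p\<leftarrow>L j. \<phi> p)"
proof -
  define f where "f k = \<phi> (block L k)" for k
  obtain m n where "fst ` F \<subseteq> {..<m}" "snd ` F \<subseteq> {..<n}"
    using finite_nat_bounded[OF finite_imageI] F(1) by metis
  then have box: "F \<subseteq> {..<J + m} \<times> {..<n}" by force
  have "f k = 0" if "k \<in> F" "fst k < J" for k
    using F(2)[of "fst k" "snd k"] that
    by (auto simp: f_def block_def split_def nth_default_def \<phi>(2) not_less[symmetric])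
  then have "sum f F = sum f (F \<inter> ({J..<J + m} \<times> {..<n}))"
    using F(1) box by (intro sum.mono_neutral_right) force+
  also have "\<dots> \<le> sum f ({J..<J + m} \<times> {..<n})"
    by (intro sum_mono2) (auto simp: f_def \<phi>)
  also have "\<dots> = (\<Sum>j=J..<J + m. \<Sum>i<n. f (j, i))" by (simp add: sum.cartesian_product)
  also have "\<dots> \<le> (\<Sum>j=J..<J + m. \<Sum>p\<leftarrow>L j. \<phi> p)"
  proof (rule sum_mono)
    fix j
    have "((\<lambda>i. f (j, i)) has_sum (\<Sum>p\<leftarrow>L j. \<phi> p)) UNIV"
      unfolding f_def block_def prod.case using \<phi>(2) by (rule has_sum_nth_default)
    then show "(\<Sum>i<n. f (j, i)) \<le> (\<Sum>p\<leftarrow>L j. \<phi> p)"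
      by (rule finite_sum_le_has_sum) (auto simp: f_def \<phi>)
  qed
  finally show ?thesis using that by (simp add: f_def)
qed

lemma square_bounded_block:
  assumes g0: "\<And>x. g (\<lambda>_. 0, \<lambda>_. 0) x = 0"
    and bound: "\<And>j x. (\<Sum>p\<leftarrow>L j. (norm (g p x))\<^sup>2) \<le> (t j * norm x)\<^sup>2"
    and t: "summable (\<lambda>j. (t j)\<^sup>2)"
    and K: "\<And>j i. (j, i) \<in> K \<Longrightarrow> i < length (L j) \<Longrightarrow> J \<le> j"
  shows "square_bounded (\<lambda>k. g (block L k)) K (sqrt (\<Sum>j. (t (j + J))\<^sup>2))"
  unfolding square_bounded_def
proof (intro allI impI)
  fix F :: "(nat \<times> nat) set" and x
  assume F: "finite F" "F \<subseteq> K"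
  obtain m where "(\<Sum>k\<in>F. (norm (g (block L k) x))\<^sup>2)
      \<le> (\<Sum>j=J..<J + m. \<Sum>p\<leftarrow>L j. (norm (g p x))\<^sup>2)"
    by (rule sum_block_le[OF F(1), where \<phi> = "\<lambda>p. (norm (g p x))\<^sup>2" and L = L and J = J])
      (use F(2) K g0 in auto)
  also have "\<dots> \<le> (\<Sum>j=J..<J + m. (t j * norm x)\<^sup>2)" by (intro sum_mono bound)
  also have "\<dots> = (\<Sum>j<m. (t (j + J))\<^sup>2) * (norm x)\<^sup>2"
    using sum.shift_bounds_nat_ivl[of "\<lambda>j. (t j * norm x)\<^sup>2" 0 J m]
    by (simp add: power_mult_distrib sum_distrib_right atLeast0LessThan add.commute)
  also have "\<dots> \<le> (\<Sum>j. (t (j + J))\<^sup>2) * (norm x)\<^sup>2"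
    using t
    by (intro mult_right_mono sum_le_suminf) (simp_all add: summable_ignore_initial_segment[OF t])
  finally have "sqrt (\<Sum>k\<in>F. (norm (g (block L k) x))\<^sup>2)
      \<le> sqrt ((\<Sum>j. (t (j + J))\<^sup>2) * (norm x)\<^sup>2)"
    by (rule real_sqrt_le_mono)
  then show "L2_set (\<lambda>k. norm (g (block L k) x)) F \<le> sqrt (\<Sum>j. (t (j + J))\<^sup>2) * norm x"
    by (simp add: L2_set_def real_sqrt_mult)
qed

definition multiplication :: "(('b \<Rightarrow> 'c::monoid_add) \<times> ('a \<Rightarrow> 'b)) list \<Rightarrow> 'a \<Rightarrow> 'c" where
  "multiplication L v = (\<Sum>(a, b)\<leftarrow>L. a (b v))"

lemma cinner_multiplication:
  "cinner \<xi> (multiplication L v) = (\<Sum>(a, b)\<leftarrow>L. cinner \<xi> (a (b v)))"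
  by (induction L) (auto simp: multiplication_def cinner.zero_right cinner_add_right)

locale square_summable_blocks =
  fixes L :: "nat \<Rightarrow> (('h::chilbert_space \<Rightarrow> 'h) \<times> ('h \<Rightarrow> 'h)) list" and t :: "nat \<Rightarrow> real"
  assumes blocks: "set (L j) \<subseteq> bounded_ops \<times> bounded_ops"
    and row_fac_le: "row_fac (L j) \<le> t j" and col_fac_le: "col_fac (L j) \<le> t j"
    and summable: "summable (\<lambda>j. (t j)\<^sup>2)"
begin

definition block_row :: "nat \<times> nat \<Rightarrow> 'h \<Rightarrow> 'h" where "block_row k = fst (block L k)"

definition block_column :: "nat \<times> nat \<Rightarrow> 'h \<Rightarrow> 'h" where "block_column k = snd (block L k)"

lemma bounded_clinear_block: "bounded_clinear (block_row k)" "bounded_clinear (block_column k)"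
proof -
  have "block L k \<in> set (L (fst k)) \<or> block L k = (\<lambda>_. 0, \<lambda>_. 0)"
    by (auto simp: block_def split_def nth_default_def)
  then show "bounded_clinear (block_row k)" "bounded_clinear (block_column k)"
    using bounded_clinear_pair[OF blocks, of "fst (block L k)" "snd (block L k)"] bounded_clinear_0
    by (auto simp: block_row_def block_column_def)
qed

lemma sum_norm_cadjoint_block_le: "(\<Sum>p\<leftarrow>L j. (norm (cadjoint (fst p) x))\<^sup>2) \<le> (t j * norm x)\<^sup>2"
proof -
  have "(row_fac (L j) * norm x)\<^sup>2 \<le> (t j * norm x)\<^sup>2"
    using row_fac_nonneg[OF blocks] by (intro power_mono mult_right_mono row_fac_le) auto
  then show ?thesis
    using sum_norm_cadjoint_le_row_fac[OF blocks[of j], of x] by (simp add: split_def)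
qed

lemma sum_norm_block_le: "(\<Sum>p\<leftarrow>L j. (norm (snd p x))\<^sup>2) \<le> (t j * norm x)\<^sup>2"
proof -
  have "(col_fac (L j) * norm x)\<^sup>2 \<le> (t j * norm x)\<^sup>2"
    using col_fac_nonneg[OF blocks] by (intro power_mono mult_right_mono col_fac_le) auto
  then show ?thesis using sum_norm_le_col_fac[OF blocks[of j], of x] by (simp add: split_def)
qed

sublocale row_column block_row block_column "sqrt (\<Sum>j. (t j)\<^sup>2)" "sqrt (\<Sum>j. (t j)\<^sup>2)"
proof (rule row_column.intro)
  show "0 \<le> sqrt (\<Sum>j. (t j)\<^sup>2)" by (simp add: suminf_nonneg summable)
  show "square_bounded (\<lambda>k. cadjoint (block_row k)) UNIV (sqrt (\<Sum>j. (t j)\<^sup>2))"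
    using square_bounded_block[of "\<lambda>p. cadjoint (fst p)" L t UNIV 0]
    by (simp add: block_row_def cadjoint_0 sum_norm_cadjoint_block_le summable)
  show "square_bounded block_column UNIV (sqrt (\<Sum>j. (t j)\<^sup>2))"
    using square_bounded_block[of snd L t UNIV 0]
    by (simp add: block_column_def[abs_def] sum_norm_block_le summable)
  fix e :: real assume "0 < e"
  then obtain J where "norm (\<Sum>j. (t (j + J))\<^sup>2) < e\<^sup>2"
    using suminf_exist_split[OF _ summable, of "e\<^sup>2"] by auto
  then have "sqrt (\<Sum>j. (t (j + J))\<^sup>2) \<le> e"
    using \<open>0 < e\<close>
    by (intro real_le_lsqrt)
      (auto intro: suminf_nonneg simp: summable_ignore_initial_segment[OF summable])
  moreover have "square_bounded block_column (- Sigma {..<J} (\<lambda>j. {..<length (L j)}))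
      (sqrt (\<Sum>j. (t (j + J))\<^sup>2))"
    unfolding block_column_def[abs_def]
    by (rule square_bounded_block[OF _ sum_norm_block_le summable]) (auto simp: not_less[symmetric])
  ultimately show "\<exists>M. finite M \<and> square_bounded block_column (- M) e"
    using square_bounded_mono by (intro exI[of _ "Sigma {..<J} (\<lambda>j. {..<length (L j)})"]) auto
qed (rule bounded_clinear_block)+

lemma sums_tens:
  "(\<lambda>j. tens (L j) \<xi> x \<eta> y) sums
    cinner \<xi> (row_op block_row (slice block_column \<eta> y \<otimes> x))"
proof -
  interpret a: bounded_clinear "block_row k" for k by (rule a_clinear)
  have "((\<lambda>k. cinner \<xi> (block_row k x) * cinner \<eta> (block_column k y)) has_sum
      cinner \<xi> (row_op block_row (slice block_column \<eta> y \<otimes> x))) UNIV"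
    using has_sum_cinner_row[of \<xi> "slice block_column \<eta> y \<otimes> x"]
    by (simp add: nth_slice a.scaleC cinner_scaleC_right mult.commute)
  then show ?thesis
    using sums_block[where L = L and \<phi> = "\<lambda>p. cinner \<xi> (fst p x) * cinner \<eta> (snd p y)"]
    by (simp add: block_row_def block_column_def tens_def split_def cinner.zero_right)
qed

lemma sums_multiplication:
  "(\<lambda>j. cinner \<xi> (multiplication (L j) v)) sums
    cinner \<xi> (row_op block_row (column_op block_column v))"
proof -
  have "((\<lambda>k. cinner \<xi> (block_row k (block_column k v))) has_sum
      cinner \<xi> (row_op block_row (column_op block_column v))) UNIV"
    using has_sum_cinner_row[of \<xi> "column_op block_column v"]
    by (simp add: ell2_nth_column[OF column_bounded])
  then show ?thesis
    using sums_block[where L = L and \<phi> = "\<lambda>p. cinner \<xi> (fst p (snd p v))"]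
    by (simp add: block_row_def block_column_def cinner_multiplication split_def cinner.zero_right)
qed

end

lemma multiplication_eq_0_if_tens_eq_0:
  assumes L: "set L \<subseteq> bounded_ops \<times> bounded_ops" and tens: "\<And>\<xi> x \<eta> y. tens L \<xi> x \<eta> y = 0"
  shows "multiplication L v = 0"
proof (rule cinner_eqI)
  fix \<xi>
  define t where "t = max (row_fac L) (col_fac L)"
  interpret blocks: square_summable_blocks
    "\<lambda>j. if j = 0 then L else []" "\<lambda>j. if j = 0 then t else 0"
  proof
    show "row_fac (if j = 0 then L else []) \<le> (if j = 0 then t else 0)"
      "col_fac (if j = 0 then L else []) \<le> (if j = 0 then t else 0)" for j :: nat
      by (simp_all add: t_def) (simp_all add: row_fac_def col_fac_def onorm_zero)
    show "summable (\<lambda>j. (if j = 0 then t else 0)\<^sup>2)"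
      by (rule summable_finite[of "{0}"]) auto
  qed (use L in auto)
  have "row_op blocks.block_row (slice blocks.block_column \<eta> y \<otimes> x) = 0" for \<eta> y x
  proof (rule cinner_eqI)
    fix \<xi>
    have "(\<lambda>j::nat. tens (if j = 0 then L else []) \<xi> x \<eta> y) = (\<lambda>j. 0)"
      using tens by (auto simp: tens_def[of "[]"])
    then show "cinner \<xi> (row_op blocks.block_row (slice blocks.block_column \<eta> y \<otimes> x))
        = cinner \<xi> 0"
      using sums_unique2[OF blocks.sums_tens[of \<xi> x \<eta> y]] by (simp add: cinner.zero_right)
  qed
  then have "(\<lambda>j::nat. cinner \<xi> (multiplication (if j = 0 then L else []) v)) sums 0"
    using blocks.sums_multiplication[of \<xi> v] blocks.row_column_eq_0[of v]
    by (simp add: cinner.zero_right)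
  moreover have "(\<lambda>j::nat. cinner \<xi> (multiplication (if j = 0 then L else []) v))
      = (\<lambda>j. if j = 0 then cinner \<xi> (multiplication L v) else 0)"
    by (auto simp: multiplication_def cinner.zero_right)
  ultimately show "cinner \<xi> (multiplication L v) = cinner \<xi> 0"
    using sums_unique2[OF sums_single[of 0 "\<lambda>_. cinner \<xi> (multiplication L v)"]]
    by (force simp: cinner.zero_right)
qed

lemma tens_append: "tens (L @ L') \<xi> x \<eta> y = tens L \<xi> x \<eta> y + tens L' \<xi> x \<eta> y"
  by (simp add: tens_def)

lemma multiplication_append: "multiplication (L @ L') v = multiplication L v + multiplication L' v"
  by (simp add: multiplication_def)

lemma multiplication_cong_tens:
  assumes L: "set L \<subseteq> bounded_ops \<times> bounded_ops" and L': "set L' \<subseteq> bounded_ops \<times> bounded_ops"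
    and eq: "tens L = tens L'"
  shows "multiplication L = multiplication L'"
proof
  fix v
  let ?M = "map (\<lambda>(a, b). (\<lambda>x. - a x, b)) L'"
  have "bounded_clinear (\<lambda>x. - a x)" if "(a, b) \<in> set L'" for a b
    using bounded_clinear_scaleR[OF bounded_clinear_pair(1)[OF L' that], of "- 1"] by simp
  then have "set ?M \<subseteq> bounded_ops \<times> bounded_ops"
    using bounded_clinear_pair(2)[OF L'] by (auto simp: bounded_ops_iff)
  moreover have "tens ?M \<xi> x \<eta> y = - tens L' \<xi> x \<eta> y" for \<xi> x \<eta> y
    by (induction L') (auto simp: tens_def cinner.minus_right)
  ultimately have "multiplication (L @ ?M) v = 0"
    using L by (intro multiplication_eq_0_if_tens_eq_0) (auto simp: tens_append eq)
  moreover have "multiplication ?M v = - multiplication L' v"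
    by (induction L') (auto simp: multiplication_def)
  ultimately show "multiplication L v = multiplication L' v"
    by (simp add: multiplication_append)
qed

definition segment :: "(nat \<Rightarrow> 'a) \<Rightarrow> (nat \<Rightarrow> 'b) \<Rightarrow> nat \<Rightarrow> nat \<Rightarrow> ('a \<times> 'b) list" where
  "segment a b m n = map (\<lambda>i. (a i, b i)) [m..<n]"

lemma segment_append: "l \<le> m \<Longrightarrow> m \<le> n \<Longrightarrow> segment a b l n = segment a b l m @ segment a b m n"
  using upt_add_eq_append[of l m "n - m"] by (simp add: segment_def)

definition increment :: "(nat \<Rightarrow> 'a) \<Rightarrow> (nat \<Rightarrow> 'b) \<Rightarrow> (nat \<Rightarrow> nat) \<Rightarrow> nat \<Rightarrow> ('a \<times> 'b) list" where
  "increment a b N j = segment a b (case j of 0 \<Rightarrow> 0 | Suc i \<Rightarrow> N i) (N j)"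

lemma sum_increments:
  fixes f :: "('a \<times> 'b) list \<Rightarrow> 'c::comm_monoid_add"
  assumes "\<And>L L'. f (L @ L') = f L + f L'" and "mono N"
  shows "(\<Sum>j\<le>J. f (increment a b N j)) = f (segment a b 0 (N J))"
proof (induction J)
  case (Suc J)
  have "N J \<le> N (Suc J)" by (rule monoD[OF \<open>mono N\<close>]) simp
  from segment_append[OF le0 this, of a b] show ?case
    using Suc by (simp add: increment_def assms(1))
qed (simp add: increment_def)

locale haagerup_Cauchy_series =
  fixes A :: "('h::chilbert_space \<Rightarrow> 'h) set" and a b :: "nat \<Rightarrow> 'h \<Rightarrow> 'h"
  assumes unital_subalgebra: "unital_subalgebra A"
    and a_mem: "a i \<in> A" and b_mem: "b i \<in> A"
    and Cauchy: "0 < e \<Longrightarrow> \<exists>N. \<forall>m n. N \<le> m \<longrightarrow> m \<le> n \<longrightarrow> haagerup_norm A (segment a b m n) < e"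
begin

lemma subset_bounded_ops: "A \<subseteq> bounded_ops"
  using unital_subalgebra by (simp add: unital_subalgebra_def)

lemma set_segment_subset: "set (segment a b m n) \<subseteq> A \<times> A"
  using a_mem b_mem by (auto simp: segment_def)

lemma fast_Cauchy_indices:
  obtains N :: "nat \<Rightarrow> nat" where "mono N" and "filterlim N at_top sequentially"
    and "\<And>j n. N j \<le> n \<Longrightarrow> haagerup_norm A (segment a b (N j) n) < ((1/2) ^ j)\<^sup>2"
proof -
  have "\<exists>N. \<forall>m n. N \<le> m \<longrightarrow> m \<le> n \<longrightarrow> haagerup_norm A (segment a b m n) < ((1/2) ^ j)\<^sup>2" for j :: nat
    by (rule Cauchy) simp
  then obtain N0 where N0: "\<And>j m n. N0 j \<le> m \<Longrightarrow> m \<le> n \<Longrightarrow>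
      haagerup_norm A (segment a b m n) < ((1/2) ^ j)\<^sup>2"
    by metis
  define N where "N j = j + (\<Sum>i\<le>j. N0 i)" for j
  have "N0 j \<le> N j" for j
    using member_le_sum[of j "{..j}" N0] by (simp add: N_def)
  moreover have "mono N" by (simp add: N_def mono_iff_le_Suc)
  moreover have "filterlim N at_top sequentially"
    by (rule filterlim_at_top_mono[OF filterlim_ident]) (simp add: N_def)
  ultimately show ?thesis using that N0 by blast
qed

lemma balanced_blocks:
  obtains N :: "nat \<Rightarrow> nat" and L t
  where "mono N" and "filterlim N at_top sequentially"
    and "\<And>j. set (L j) \<subseteq> A \<times> A" and "\<And>j. tens (L j) = tens (increment a b N j)"
    and "\<And>j. row_fac (L j) \<le> t j" and "\<And>j. col_fac (L j) \<le> t j"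
    and "summable (\<lambda>j. (t j :: real)\<^sup>2)"
proof -
  obtain N where N: "mono N" "filterlim N at_top sequentially"
    and small: "\<And>j n. N j \<le> n \<Longrightarrow> haagerup_norm A (segment a b (N j) n) < ((1/2) ^ j)\<^sup>2"
    by (rule fast_Cauchy_indices) blast
  define t where
    "t j = (case j of 0 \<Rightarrow> 1 + \<bar>haagerup_norm A (increment a b N 0)\<bar> | Suc i \<Rightarrow> (1/2) ^ i)" for j
  have "\<exists>L. set L \<subseteq> A \<times> A \<and> tens L = tens (increment a b N j) \<and> row_fac L \<le> t j \<and> col_fac L \<le> t j"
    for j
  proof -
    have "set (increment a b N j) \<subseteq> A \<times> A" unfolding increment_def by (rule set_segment_subset)
    moreover have "0 < t j" by (simp add: t_def add_pos_nonneg split: nat.split)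
    moreover have "haagerup_norm A (increment a b N j) < (t j)\<^sup>2"
    proof (cases j)
      case 0
      have "h < (1 + \<bar>h\<bar>)\<^sup>2" for h :: real
        using zero_le_power2[of h] unfolding power2_sum power2_abs power_one by linarith
      then show ?thesis using 0 by (simp add: t_def)
    next
      case (Suc i)
      then show ?thesis
        using small[OF monoD[OF N(1)], of i "Suc i"] by (simp add: increment_def t_def)
    qed
    ultimately show ?thesis using balanced_representation[OF unital_subalgebra] by metis
  qed
  then obtain L where "\<And>j. set (L j) \<subseteq> A \<times> A" "\<And>j. tens (L j) = tens (increment a b N j)"
    "\<And>j. row_fac (L j) \<le> t j" "\<And>j. col_fac (L j) \<le> t j"
    by metis
  moreover have "summable (\<lambda>j. (t j)\<^sup>2)"
    using summable_geometric[of "1/4::real"] summable_Suc_iff[of "\<lambda>j. (t j)\<^sup>2"]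
    by (simp add: t_def power2_eq_square flip: power_mult_distrib)
  ultimately show ?thesis using that N by blast
qed

lemma row_column_representation:
  obtains c d :: "nat \<times> nat \<Rightarrow> 'h \<Rightarrow> 'h" and \<alpha> \<beta> and N :: "nat \<Rightarrow> nat"
  where "row_column c d \<alpha> \<beta>" and "filterlim N at_top sequentially"
    and "\<And>\<xi> x \<eta> y. (\<lambda>J. tens (segment a b 0 (N J)) \<xi> x \<eta> y)
      \<longlonglongrightarrow> cinner \<xi> (row_op c (slice d \<eta> y \<otimes> x))"
    and "\<And>\<xi> v. (\<lambda>J. cinner \<xi> (multiplication (segment a b 0 (N J)) v))
      \<longlonglongrightarrow> cinner \<xi> (row_op c (column_op d v))"
proof -
  obtain N L t where N: "mono N" "filterlim N at_top sequentially"
    and L: "\<And>j. set (L j) \<subseteq> A \<times> A"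
    and tens: "\<And>j. tens (L j) = tens (increment a b N j)"
    and fac: "\<And>j. row_fac (L j) \<le> t j" "\<And>j. col_fac (L j) \<le> t j" "summable (\<lambda>j. (t j)\<^sup>2)"
    using balanced_blocks by metis
  have AB: "A \<times> A \<subseteq> bounded_ops \<times> bounded_ops" using subset_bounded_ops by blast
  have LB: "set (L j) \<subseteq> bounded_ops \<times> bounded_ops" for j using L AB by (rule order_trans)
  have mult: "multiplication (L j) = multiplication (increment a b N j)" for j
    unfolding increment_def
    by (intro multiplication_cong_tens LB tens[unfolded increment_def]
        order_trans[OF set_segment_subset AB])
  interpret blocks: square_summable_blocks L t by standard (rule LB fac)+
  have "(\<lambda>J. tens (segment a b 0 (N J)) \<xi> x \<eta> y) \<longlonglongrightarrow> cinner \<xi>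
      (row_op blocks.block_row (slice blocks.block_column \<eta> y \<otimes> x))" for \<xi> x \<eta> y
    using blocks.sums_tens[of \<xi> x \<eta> y]
    unfolding sums_def_le tens sum_increments[of "\<lambda>L. tens L \<xi> x \<eta> y", OF tens_append N(1)] .
  moreover have "(\<lambda>J. cinner \<xi> (multiplication (segment a b 0 (N J)) v)) \<longlonglongrightarrow> cinner \<xi>
      (row_op blocks.block_row (column_op blocks.block_column v))" for \<xi> v
    using blocks.sums_multiplication[of \<xi> v]
    unfolding sums_def_le mult cinner.sum_right[symmetric]
      sum_increments[of "\<lambda>L. multiplication L v", OF multiplication_append N(1)] .
  ultimately show ?thesis using that[OF blocks.row_column_axioms N(2)] by blast
qed

lemma norm_tens_segment_le:
  assumes "0 < e"
  obtains N where "\<And>n \<xi> x \<eta> y. N \<le> n \<Longrightarrow> (\<And>k. k < N \<Longrightarrow> cinner \<eta> (b k y) = 0) \<Longrightarrow>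
    cmod (tens (segment a b 0 n) \<xi> x \<eta> y) \<le> e * (norm \<xi> * norm x * norm \<eta> * norm y)"
proof -
  obtain N where N: "\<And>n. N \<le> n \<Longrightarrow> haagerup_norm A (segment a b N n) < e"
    using Cauchy[OF assms] by blast
  have "cmod (tens (segment a b 0 n) \<xi> x \<eta> y) \<le> e * (norm \<xi> * norm x * norm \<eta> * norm y)"
    if n: "N \<le> n" and y: "\<And>k. k < N \<Longrightarrow> cinner \<eta> (b k y) = 0" for n \<xi> x \<eta> y
  proof -
    have "tens (segment a b 0 N) \<xi> x \<eta> y = 0"
      by (simp add: tens_def segment_def sum_list_conv_sum_nth y)
    then have "tens (segment a b 0 n) \<xi> x \<eta> y = tens (segment a b N n) \<xi> x \<eta> y"
      by (simp add: segment_append[OF le0 n] tens_append)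
    also have "cmod \<dots> \<le> haagerup_norm A (segment a b N n) * (norm \<xi> * norm x * norm \<eta> * norm y)"
      by (rule norm_tens_le_haagerup_norm[OF subset_bounded_ops set_segment_subset])
    also have "\<dots> \<le> e * (norm \<xi> * norm x * norm \<eta> * norm y)"
      using N[OF n] by (intro mult_right_mono) auto
    finally show ?thesis .
  qed
  then show ?thesis using that by blast
qed

end

section \<open>Diagonals\<close>

locale haagerup_diagonal = haagerup_Cauchy_series A a b
  for A :: "('h::chilbert_space \<Rightarrow> 'h) set" and a b +
  assumes unit: "(\<lambda>n. onorm (\<lambda>x. (\<Sum>i<n. a i (b i x)) - x)) \<longlonglongrightarrow> 0"
    and commute: "T \<in> A \<Longrightarrow> (\<lambda>n. haagerup_norm A
      (map (\<lambda>i. (T \<circ> a i, b i)) [0..<n] @ map (\<lambda>i. (- a i, b i \<circ> T)) [0..<n])) \<longlonglongrightarrow> 0"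
begin

lemma multiplication_tendsto: "(\<lambda>n. multiplication (segment a b 0 n) v) \<longlonglongrightarrow> v"
proof (rule LIM_zero_cancel, rule Lim_null_comparison)
  have ab: "bounded_linear (a i)" "bounded_linear (b i)" for i
    using a_mem b_mem subset_bounded_ops by (auto simp: bounded_ops_def)
  have "norm (multiplication (segment a b 0 n) v - v)
      \<le> onorm (\<lambda>x. (\<Sum>i<n. a i (b i x)) - x) * norm v" for n
  proof -
    have "bounded_linear (\<lambda>x. (\<Sum>i<n. a i (b i x)) - x)"
      by (intro bounded_linear_sub bounded_linear_sum bounded_linear_ident
          bounded_linear_compose[OF ab])
    from onorm[OF this, of v] show ?thesis
      by (simp add: multiplication_def segment_def sum_list_conv_sum_nth)
  qed
  then show "\<forall>\<^sub>F n in sequentially. norm (multiplication (segment a b 0 n) v - v)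
      \<le> onorm (\<lambda>x. (\<Sum>i<n. a i (b i x)) - x) * norm v"
    by (rule always_eventually[OF allI])
  show "(\<lambda>n. onorm (\<lambda>x. (\<Sum>i<n. a i (b i x)) - x) * norm v) \<longlonglongrightarrow> 0"
    using tendsto_mult_right[OF unit, of "norm v"] by (simp add: mult.commute)
qed

lemma tens_commutator_tendsto:
  assumes T: "T \<in> A"
  shows "(\<lambda>n. tens (segment a b 0 n) (cadjoint T \<xi>) x \<eta> y - tens (segment a b 0 n) \<xi> x \<eta> (T y)) \<longlonglongrightarrow> 0"
proof (rule Lim_null_comparison)
  define C where "C n = map (\<lambda>i. (T \<circ> a i, b i)) [0..<n] @ map (\<lambda>i. (- a i, b i \<circ> T)) [0..<n]" for n
  define K where "K = norm \<xi> * norm x * norm \<eta> * norm y"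
  have clinear: "bounded_clinear T" using T subset_bounded_ops by (auto simp: bounded_ops_iff)
  have tens_C: "tens (C n) \<xi> x \<eta> y
      = tens (segment a b 0 n) (cadjoint T \<xi>) x \<eta> y - tens (segment a b 0 n) \<xi> x \<eta> (T y)" for n
    by (simp add: C_def tens_append)
      (simp add: tens_def segment_def o_def cinner_cadjoint_left[OF clinear] cinner.minus_right
        sum_list_conv_sum_nth sum_negf)
  have "- S \<in> A" if "S \<in> A" for S
  proof -
    have "(\<lambda>x. scaleC (- 1) (S x)) \<in> A"
      using unital_subalgebra that by (simp add: unital_subalgebra_def)
    then show ?thesis by (simp add: scaleC.minus_left fun_Compl_def)
  qed
  then have "set (C n) \<subseteq> A \<times> A" for n
    using a_mem b_mem T unital_subalgebra by (auto simp: C_def unital_subalgebra_def)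
  from norm_tens_le_haagerup_norm[OF subset_bounded_ops this]
  show "\<forall>\<^sub>F n in sequentially. norm (tens (segment a b 0 n) (cadjoint T \<xi>) x \<eta> y
      - tens (segment a b 0 n) \<xi> x \<eta> (T y)) \<le> haagerup_norm A (C n) * K"
    by (intro always_eventually allI) (simp add: K_def flip: tens_C)
  show "(\<lambda>n. haagerup_norm A (C n) * K) \<longlonglongrightarrow> 0"
    using tendsto_mult_left_zero[OF commute[OF T], of K] by (simp add: C_def)
qed

context
  fixes R :: "'h \<Rightarrow> 'h \<Rightarrow> 'h" and \<eta> and N :: "nat \<Rightarrow> nat"
  assumes N: "filterlim N at_top sequentially"
    and slice_limit: "\<And>\<xi> x y. (\<lambda>J. tens (segment a b 0 (N J)) \<xi> x \<eta> y) \<longlonglongrightarrow> cinner \<xi> (R y x)"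
begin

lemma limit_slice_commute:
  assumes T: "T \<in> A"
  shows "T (R y x) = R (T y) x"
proof (rule cinner_eqI)
  fix \<xi>
  have "bounded_clinear T" using T subset_bounded_ops by (auto simp: bounded_ops_iff)
  moreover have "cinner (cadjoint T \<xi>) (R y x) - cinner \<xi> (R (T y) x) = 0"
    using tendsto_diff[OF slice_limit slice_limit]
      filterlim_compose[OF tens_commutator_tendsto[OF T] N]
    by (rule LIMSEQ_unique)
  ultimately show "cinner \<xi> (T (R y x)) = cinner \<xi> (R (T y) x)"
    by (simp add: cinner_cadjoint_left)
qed

lemma norm_limit_slice_le:
  assumes "0 < e"
  obtains M where "\<And>x y. (\<And>k. k < M \<Longrightarrow> cinner \<eta> (b k y) = 0) \<Longrightarrow>
    norm (R y x) \<le> e * (norm x * norm \<eta> * norm y)"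
proof -
  obtain M where M: "\<And>n \<xi> x y. M \<le> n \<Longrightarrow> (\<And>k. k < M \<Longrightarrow> cinner \<eta> (b k y) = 0) \<Longrightarrow>
      cmod (tens (segment a b 0 n) \<xi> x \<eta> y) \<le> e * (norm \<xi> * norm x * norm \<eta> * norm y)"
    using norm_tens_segment_le[OF assms] by metis
  have "norm (R y x) \<le> e * (norm x * norm \<eta> * norm y)"
    if y: "\<And>k. k < M \<Longrightarrow> cinner \<eta> (b k y) = 0" for x y
  proof (rule norm_le_if_cinner_le)
    fix \<xi>
    have "\<forall>\<^sub>F J in sequentially. M \<le> N J" using N by (simp add: filterlim_at_top)
    then have "\<forall>\<^sub>F J in sequentially. cmod (tens (segment a b 0 (N J)) \<xi> x \<eta> y)
        \<le> e * (norm \<xi> * norm x * norm \<eta> * norm y)"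
      by eventually_elim (rule M[OF _ y])
    with tendsto_norm[OF slice_limit]
    have "cmod (cinner \<xi> (R y x)) \<le> e * (norm \<xi> * norm x * norm \<eta> * norm y)"
      by (rule tendsto_upperbound) simp
    then show "cmod (cinner \<xi> (R y x)) \<le> e * (norm x * norm \<eta> * norm y) * norm \<xi>"
      by (simp add: mult_ac)
  qed (use assms in simp)
  then show ?thesis using that by blast
qed

lemma limit_slice_in_compact_multipliers: "R y \<in> compact_multipliers A"
  unfolding compact_multipliers_def
proof safe
  fix e :: real assume "0 < e"
  define d where "d = e / (norm \<eta> * norm y + 1)"
  have pos: "0 < norm \<eta> * norm y + 1" by (simp add: add_nonneg_pos)
  then have d: "0 < d" "d * (norm \<eta> * norm y) \<le> e"
    using \<open>0 < e\<close> by (simp_all add: d_def field_simps)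
  obtain M where M: "\<And>x y. (\<And>k. k < M \<Longrightarrow> cinner \<eta> (b k y) = 0) \<Longrightarrow>
      norm (R y x) \<le> d * (norm x * norm \<eta> * norm y)"
    using norm_limit_slice_le[OF d(1)] by metis
  define \<Phi> where "\<Phi> = (\<lambda>k. (cadjoint (b k) \<eta>, y)) ` {..<M}"
  have "norm (T (R y x)) \<le> e * onorm T * norm x" if T: "T \<in> A" "vanishes_on \<Phi> T" for T x
  proof -
    have bl: "bounded_linear T" using T(1) subset_bounded_ops by (auto simp: bounded_ops_def)
    have "bounded_clinear (b k)" for k
      using b_mem subset_bounded_ops by (auto simp flip: bounded_ops_iff)
    then have "cinner \<eta> (b k (T y)) = 0" if "k < M" for k
      using T(2) that by (auto simp: vanishes_on_def \<Phi>_def cinner_cadjoint_left)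
    then have "norm (T (R y x)) \<le> d * (norm x * norm \<eta> * norm (T y))"
      unfolding limit_slice_commute[OF T(1)] by (rule M)
    also have "\<dots> \<le> d * (norm x * norm \<eta> * (onorm T * norm y))"
      using d(1) onorm[OF bl] by (intro mult_left_mono) auto
    also have "\<dots> = d * (norm \<eta> * norm y) * (onorm T * norm x)" by (simp add: mult_ac)
    also have "\<dots> \<le> e * (onorm T * norm x)"
      by (intro mult_right_mono d(2)) (simp add: onorm_pos_le[OF bl])
    finally show ?thesis by (simp add: mult.assoc)
  qed
  then show "\<exists>\<Phi>. finite \<Phi> \<and> (\<forall>T\<in>A. vanishes_on \<Phi> T \<longrightarrow>
      (\<forall>x. norm (T (R y x)) \<le> e * onorm T * norm x))"
    by (intro exI[of _ \<Phi>]) (auto simp: \<Phi>_def)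
qed

end

lemma row_column_diagonal:
  obtains c d :: "nat \<times> nat \<Rightarrow> 'h \<Rightarrow> 'h" and \<alpha> \<beta>
  where "row_column c d \<alpha> \<beta>" and "\<And>v. row_op c (column_op d v) = v"
    and "\<And>\<eta> y. (\<lambda>x. row_op c (slice d \<eta> y \<otimes> x)) \<in> compact_multipliers A"
proof -
  obtain c d :: "nat \<times> nat \<Rightarrow> 'h \<Rightarrow> 'h" and \<alpha> \<beta> N where rc: "row_column c d \<alpha> \<beta>"
    and N: "filterlim N at_top sequentially"
    and tens_lim: "\<And>\<xi> x \<eta> y. (\<lambda>J. tens (segment a b 0 (N J)) \<xi> x \<eta> y)
      \<longlonglongrightarrow> cinner \<xi> (row_op c (slice d \<eta> y \<otimes> x))"
    and mult_lim: "\<And>\<xi> v. (\<lambda>J. cinner \<xi> (multiplication (segment a b 0 (N J)) v))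
      \<longlonglongrightarrow> cinner \<xi> (row_op c (column_op d v))"
    using row_column_representation by metis
  show ?thesis
  proof (rule that[OF rc])
    show "row_op c (column_op d v) = v" for v
    proof (rule cinner_eqI)
      show "cinner \<xi> (row_op c (column_op d v)) = cinner \<xi> v" for \<xi>
        using mult_lim[of \<xi> v]
          cinner.tendsto[OF tendsto_const filterlim_compose[OF multiplication_tendsto N]]
        by (rule LIMSEQ_unique)
    qed
    show "(\<lambda>x. row_op c (slice d \<eta> y \<otimes> x)) \<in> compact_multipliers A" for \<eta> y
      by (rule limit_slice_in_compact_multipliers[OF N tens_lim])
  qed
qed

end

lemma has_diagonal_iff:
  assumes "unital_subalgebra A"
  shows "has_diagonal A \<longleftrightarrow> (\<exists>a b. haagerup_diagonal A a b)"
  using assms unfolding has_diagonal_def haagerup_diagonal_def haagerup_Cauchy_series_def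
    haagerup_diagonal_axioms_def segment_def by (simp add: all_conj_distrib Ball_def conj_assoc)

theorem theorem2p1:
  fixes A :: "('h::chilbert_space \<Rightarrow> 'h) set"
  assumes "unital_subalgebra A"
    and "has_diagonal A"
  shows "finite_dim_ops A"
proof -
  obtain a b :: "nat \<Rightarrow> 'h \<Rightarrow> 'h" where "haagerup_diagonal A a b"
    using assms by (auto simp: has_diagonal_iff)
  then obtain c d :: "nat \<times> nat \<Rightarrow> 'h \<Rightarrow> 'h" and \<alpha> \<beta> where "row_column c d \<alpha> \<beta>"
    and unit: "\<And>v. row_op c (column_op d v) = v"
    and slices: "\<And>\<eta> y. (\<lambda>x. row_op c (slice d \<eta> y \<otimes> x)) \<in> compact_multipliers A"
    by (rule haagerup_diagonal.row_column_diagonal) blast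
  interpret row_column c d \<alpha> \<beta> by fact
  have "A \<subseteq> Collect bounded_linear"
    using assms(1) by (auto simp: unital_subalgebra_def bounded_ops_def)
  from compact_multipliers_row_column[OF this slices]
  have "(\<lambda>v. v) \<in> compact_multipliers A" by (simp add: unit)
  then show "finite_dim_ops A"
    by (rule finite_dim_ops_if_identity_compact[OF assms(1)])
qed

end
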